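(* Let $\mathcal{D}$ be a dense subspace of a complex Hilbert space $\mathcal{H}$ and let $\Omega$ be a solvable sesquilinear form on $\mathcal{D}$ with respect to a norm $\|\cdot\|_\Omega$ and with numerical range $\mathfrak{n}_\Omega$ contained in a strip $\mathsf{S}$. Let $T$ be its associated operator, with numerical range $\mathfrak{n}_T$. Then $\overline{\mathfrak{n}_T}^c\subseteq\rho(T)$ and $T$ is $\mathfrak{n}$-maximal, where $\mathfrak{n}$ is any proper, convex subset of $\mathbb{C}$ containing $\mathfrak{n}_T$.
   Context: $\mathcal{H}$ is a complex Hilbert space with inner product $\langle\cdot|\cdot\rangle$ and norm $\|\cdot\|$. $E^c=\mathbb{C}\setminus E$ and $\overline{E}$ is the closure, for $E\subseteq\mathbb{C}$. An operator $T$ on $\mathcal{H}$ is a linear map from a linear subspace $D(T)\subseteq\mathcal{H}$ to $\mathcal{H}$, and $T\subseteq T'$ means that $T'$ extends $T$; $\rho(T)$ is the set of $\lambda\in\mathbb{C}$ such that $T-\lambda I:D(T)\to\mathcal{H}$ is a bijection with bounded inverse. Numerical ranges: $\mathfrak{n}_T=\{\langle T\xi|\xi\rangle:\xi\in D(T),\|\xi\|=1\}$ for an operator, and $\mathfrak{n}_\Omega=\{\Omega(\xi,\xi):\xi\in\mathcal{D},\|\xi\|=1\}$ for a sesquilinear form $\Omega$ on $\mathcal{D}$. $\mathfrak{n}$-maximality: for a nonempty, convex, proper subset $\mathfrak{n}$ of $\mathbb{C}$, $T$ is $\mathfrak{n}$-maximal if $\mathfrak{n}_T\subseteq\mathfrak{n}$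 and whenever $T\subseteq T'$ and $\mathfrak{n}_{T'}\subseteq\mathfrak{n}$, then $T=T'$. Strip: a set $\mathsf{S}=a\,\mathsf{S}_\alpha+b$ with $a\in\mathbb{C}\setminus\{0\}$, $b\in\mathbb{R}$, $\alpha\ge0$, where $\{\lambda\in\mathbb{C}:|\Im\lambda|<\alpha\}\subseteq\mathsf{S}_\alpha\subseteq\{\lambda\in\mathbb{C}:|\Im\lambda|\le\alpha\}$. q-closed forms: a sesquilinear form $\Omega$ on $\mathcal{D}$ is q-closed with respect to a norm $\|\cdot\|_\Omega$ on $\mathcal{D}$ if (1) there is $\alpha>0$ with $\|\xi\|\le\alpha\|\xi\|_\Omega$ for all $\xi\in\mathcal{D}$; (2) $\mathcal{E}_\Omega:=\mathcal{D}[\|\cdot\|_\Omega]$ (the space $\mathcal{D}$ with norm $\|\cdot\|_\Omega$) is a reflexive Banach space; (3) there is $\beta>0$ with $|\Omega(\xi,\eta)|\le\beta\|\xi\|_\Omega\|\eta\|_\Omega$ for all $\xi,\eta\in\mathcal{D}$. Solvable forms: let $\Omega$ be q-closed with respect to $\|\cdot\|_\Omega$ and let $\mathcal{E}_\Omega^\times$ be the conjugate dual of $\mathcal{E}_\Omega$ (bounded conjugate-linear functionals $\Lambda$, with action written $\langle\Lambda|\eta\rangle$). $\mathfrak{P}(\Omega)$ is the set of bounded sesquilinear forms $\Upsilon$ on $\mathcal{H}$ such that (1) if $\xi\in\mathcal{D}$ and $(\Omega+\Upsilon)(\xi,\eta)=0$ for all $\eta\in\mathcal{D}$, then $\xi=0$;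 (2) for every $\Lambda\in\mathcal{E}_\Omega^\times$ there is $\xi\in\mathcal{E}_\Omega$ with $\langle\Lambda|\eta\rangle=(\Omega+\Upsilon)(\xi,\eta)$ for all $\eta\in\mathcal{E}_\Omega$. $\Omega$ is solvable with respect to $\|\cdot\|_\Omega$ if $\mathfrak{P}(\Omega)\ne\varnothing$. Associated operator: $D(T)=\{\xi\in\mathcal{D}:\exists\chi\in\mathcal{H},\ \Omega(\xi,\eta)=\langle\chi|\eta\rangle\ \forall\eta\in\mathcal{D}\}$ and $T\xi=\chi$. *)

theory Defs
  imports "HOL-Analysis.Analysis" "HOL-Library.Function_Algebras"
begin

section \<open>Complex vector spaces and complex Hilbert spaces\<close>

class complex_vector = ab_group_add +
  fixes scaleC :: "complex \<Rightarrow> 'a \<Rightarrow> 'a" (infixr \<open>*\<^sub>C\<close> 75)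
  assumes scaleC_add_right: "a *\<^sub>C (x + y) = a *\<^sub>C x + a *\<^sub>C y"
    and scaleC_add_left: "(a + b) *\<^sub>C x = a *\<^sub>C x + b *\<^sub>C x"
    and scaleC_scaleC: "a *\<^sub>C b *\<^sub>C x = (a * b) *\<^sub>C x"
    and scaleC_one: "1 *\<^sub>C x = x"

global_interpretation complex_vector:
  vector_space "scaleC :: complex \<Rightarrow> 'a \<Rightarrow> 'a::complex_vector"
  by unfold_locales
    (simp_all add: scaleC_add_right scaleC_add_left scaleC_scaleC scaleC_one)

instantiation complex :: complex_vector
begin

definition scaleC_complex :: "complex \<Rightarrow> complex \<Rightarrow> complex"
  where "scaleC_complex a x = a * x"

instance
  by standard (simp_all add: scaleC_complex_def algebra_simps)

end

instantiation "fun" :: (type, complex_vector) complex_vector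
begin

definition scaleC_fun :: "complex \<Rightarrow> ('a \<Rightarrow> 'b) \<Rightarrow> 'a \<Rightarrow> 'b"
  where "scaleC_fun a f = (\<lambda>x. a *\<^sub>C f x)"

instance
  by standard
    (simp_all add: scaleC_fun_def fun_eq_iff scaleC_add_right scaleC_add_left
      scaleC_scaleC scaleC_one)

end

text \<open>The inner product is linear in its first argument. Completeness and the topology
  are those of the library class \<^class>\<open>banach\<close>.\<close>

class complex_hilbert_space = complex_vector + banach +
  fixes cinner :: "'a \<Rightarrow> 'a \<Rightarrow> complex"
  assumes scaleR_scaleC: "r *\<^sub>R x = complex_of_real r *\<^sub>C x"
    and cinner_commute: "cinner x y = cnj (cinner y x)"
    and cinner_add_left: "cinner (x + y) z = cinner x z + cinner y z"
    and cinner_scaleC_left: "cinner (a *\<^sub>C x) y = a * cinner x y"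
    and cinner_self: "cinner x x = complex_of_real ((norm x)\<^sup>2)"

text \<open>The class is inhabited.\<close>

instantiation complex :: complex_hilbert_space
begin

definition cinner_complex :: "complex \<Rightarrow> complex \<Rightarrow> complex"
  where "cinner_complex x y = x * cnj y"

instance
  by standard
    (simp_all add: scaleC_complex_def cinner_complex_def scaleR_conv_of_real
      algebra_simps complex_norm_square [symmetric] del: of_real_power)

end

section \<open>Norms, dual spaces and reflexivity on a linear subspace\<close>

definition linear_functional_on :: "'v::complex_vector set \<Rightarrow> ('v \<Rightarrow> complex) \<Rightarrow> bool"
  where "linear_functional_on V f \<longleftrightarrow>
    (\<forall>x\<in>V. \<forall>y\<in>V. f (x + y) = f x + f y) \<and> (\<forall>c. \<forall>x\<in>V. f (c *\<^sub>C x) = c * f x)"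

definition conj_linear_functional_on :: "'v::complex_vector set \<Rightarrow> ('v \<Rightarrow> complex) \<Rightarrow> bool"
  where "conj_linear_functional_on V f \<longleftrightarrow>
    (\<forall>x\<in>V. \<forall>y\<in>V. f (x + y) = f x + f y) \<and> (\<forall>c. \<forall>x\<in>V. f (c *\<^sub>C x) = cnj c * f x)"

definition bounded_functional_on :: "'v set \<Rightarrow> ('v \<Rightarrow> real) \<Rightarrow> ('v \<Rightarrow> complex) \<Rightarrow> bool"
  where "bounded_functional_on V N f \<longleftrightarrow> (\<exists>M. \<forall>x\<in>V. cmod (f x) \<le> M * N x)"

definition norm_on :: "'v::complex_vector set \<Rightarrow> ('v \<Rightarrow> real) \<Rightarrow> bool"
  where "norm_on V N \<longleftrightarrow>
    (\<forall>x\<in>V. 0 \<le> N x) \<and> (\<forall>x\<in>V. N x = 0 \<longleftrightarrow> x = 0) \<and>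
    (\<forall>c. \<forall>x\<in>V. N (c *\<^sub>C x) = cmod c * N x) \<and>
    (\<forall>x\<in>V. \<forall>y\<in>V. N (x + y) \<le> N x + N y)"

text \<open>Functionals on \<open>V\<close> are represented uniquely by functions vanishing outside \<open>V\<close>, so
  that the dual is a linear subspace of the function space.\<close>

definition dual_on :: "'v::complex_vector set \<Rightarrow> ('v \<Rightarrow> real) \<Rightarrow> ('v \<Rightarrow> complex) set"
  where "dual_on V N =
    {f. linear_functional_on V f \<and> bounded_functional_on V N f \<and> (\<forall>x. x \<notin> V \<longrightarrow> f x = 0)}"

definition conj_dual_on :: "'v::complex_vector set \<Rightarrow> ('v \<Rightarrow> real) \<Rightarrow> ('v \<Rightarrow> complex) set"
  where "conj_dual_on V N =
    {f. conj_linear_functional_on V f \<and> bounded_functional_on V N f \<and>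
        (\<forall>x. x \<notin> V \<longrightarrow> f x = 0)}"

definition dual_norm_on :: "'v set \<Rightarrow> ('v \<Rightarrow> real) \<Rightarrow> ('v \<Rightarrow> complex) \<Rightarrow> real"
  where "dual_norm_on V N f = (SUP x\<in>{x\<in>V. N x \<le> 1}. cmod (f x))"

text \<open>Reflexivity: the canonical map into the bidual is onto.\<close>

definition reflexive_on :: "'v::complex_vector set \<Rightarrow> ('v \<Rightarrow> real) \<Rightarrow> bool"
  where "reflexive_on V N \<longleftrightarrow>
    (\<forall>\<Phi> \<in> dual_on (dual_on V N) (dual_norm_on V N). \<exists>x\<in>V. \<forall>f\<in>dual_on V N. \<Phi> f = f x)"

definition reflexive_banach_on :: "'v::complex_vector set \<Rightarrow> ('v \<Rightarrow> real) \<Rightarrow> bool"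
  where "reflexive_banach_on V N \<longleftrightarrow>
    complex_vector.subspace V \<and> norm_on V N \<and>
    Metric_space.mcomplete V (\<lambda>x y. N (x - y)) \<and> reflexive_on V N"

section \<open>Sesquilinear forms\<close>

definition sesquilinear_on ::
    "'a::complex_vector set \<Rightarrow> ('a \<Rightarrow> 'a \<Rightarrow> complex) \<Rightarrow> bool"
  where "sesquilinear_on D \<Omega> \<longleftrightarrow>
    (\<forall>\<eta>\<in>D. linear_functional_on D (\<lambda>\<xi>. \<Omega> \<xi> \<eta>)) \<and>
    (\<forall>\<xi>\<in>D. conj_linear_functional_on D (\<Omega> \<xi>))"

definition bounded_sesquilinear :: "('a::complex_hilbert_space \<Rightarrow> 'a \<Rightarrow> complex) \<Rightarrow> bool"
  where "bounded_sesquilinear \<Upsilon> \<longleftrightarrow>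
    sesquilinear_on UNIV \<Upsilon> \<and> (\<exists>M. \<forall>\<xi> \<eta>. cmod (\<Upsilon> \<xi> \<eta>) \<le> M * norm \<xi> * norm \<eta>)"

definition q_closed ::
    "'a::complex_hilbert_space set \<Rightarrow> ('a \<Rightarrow> 'a \<Rightarrow> complex) \<Rightarrow> ('a \<Rightarrow> real) \<Rightarrow> bool"
  where "q_closed D \<Omega> N \<longleftrightarrow>
    (\<exists>\<alpha>>0. \<forall>\<xi>\<in>D. norm \<xi> \<le> \<alpha> * N \<xi>) \<and>
    reflexive_banach_on D N \<and>
    (\<exists>\<beta>>0. \<forall>\<xi>\<in>D. \<forall>\<eta>\<in>D. cmod (\<Omega> \<xi> \<eta>) \<le> \<beta> * N \<xi> * N \<eta>)"

definition perturbations ::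
    "'a::complex_hilbert_space set \<Rightarrow> ('a \<Rightarrow> 'a \<Rightarrow> complex) \<Rightarrow> ('a \<Rightarrow> real) \<Rightarrow>
      ('a \<Rightarrow> 'a \<Rightarrow> complex) set" (\<open>\<PP>\<close>)
  where "\<PP> D \<Omega> N =
    {\<Upsilon>. bounded_sesquilinear \<Upsilon> \<and>
      (\<forall>\<xi>\<in>D. (\<forall>\<eta>\<in>D. \<Omega> \<xi> \<eta> + \<Upsilon> \<xi> \<eta> = 0) \<longrightarrow> \<xi> = 0) \<and>
      (\<forall>\<Lambda>\<in>conj_dual_on D N. \<exists>\<xi>\<in>D. \<forall>\<eta>\<in>D. \<Lambda> \<eta> = \<Omega> \<xi> \<eta> + \<Upsilon> \<xi> \<eta>)}"

definition solvable ::
    "'a::complex_hilbert_space set \<Rightarrow> ('a \<Rightarrow> 'a \<Rightarrow> complex) \<Rightarrow> ('a \<Rightarrow> real) \<Rightarrow> bool"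
  where "solvable D \<Omega> N \<longleftrightarrow> q_closed D \<Omega> N \<and> \<PP> D \<Omega> N \<noteq> {}"

definition form_numerical_range ::
    "'a::complex_hilbert_space set \<Rightarrow> ('a \<Rightarrow> 'a \<Rightarrow> complex) \<Rightarrow> complex set"
  where "form_numerical_range D \<Omega> = {\<Omega> \<xi> \<xi> | \<xi>. \<xi> \<in> D \<and> norm \<xi> = 1}"

section \<open>Operators\<close>

text \<open>Operators are partial maps, so that \<^const>\<open>map_le\<close> is extension of operators and
  equality of maps is equality of operators, domains included.\<close>

type_synonym 'a op = "'a \<rightharpoonup> 'a"

abbreviation op_app :: "'a op \<Rightarrow> 'a \<Rightarrow> 'a"  (infixl \<open>\<bullet>\<bullet>\<close> 90)
  where "T \<bullet>\<bullet> x \<equiv> the (T x)"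

definition operator :: "'a::complex_vector op \<Rightarrow> bool"
  where "operator T \<longleftrightarrow>
    complex_vector.subspace (dom T) \<and>
    (\<forall>x\<in>dom T. \<forall>y\<in>dom T. T \<bullet>\<bullet> (x + y) = T \<bullet>\<bullet> x + T \<bullet>\<bullet> y) \<and>
    (\<forall>c. \<forall>x\<in>dom T. T \<bullet>\<bullet> (c *\<^sub>C x) = c *\<^sub>C (T \<bullet>\<bullet> x))"

definition numerical_range :: "'a::complex_hilbert_space op \<Rightarrow> complex set"
  where "numerical_range T = {cinner (T \<bullet>\<bullet> \<xi>) \<xi> | \<xi>. \<xi> \<in> dom T \<and> norm \<xi> = 1}"

definition resolvent_set :: "'a::complex_hilbert_space op \<Rightarrow> complex set"
  where "resolvent_set T =
    {z. bij_betw (\<lambda>x. T \<bullet>\<bullet> x - z *\<^sub>C x) (dom T) UNIV \<and>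
        bounded_linear (inv_into (dom T) (\<lambda>x. T \<bullet>\<bullet> x - z *\<^sub>C x))}"

definition n_maximal :: "complex set \<Rightarrow> 'a::complex_hilbert_space op \<Rightarrow> bool"
  where "n_maximal \<nn> T \<longleftrightarrow>
    \<nn> \<noteq> {} \<and> convex \<nn> \<and> \<nn> \<noteq> UNIV \<and>
    operator T \<and> numerical_range T \<subseteq> \<nn> \<and>
    (\<forall>T'. operator T' \<and> T \<subseteq>\<^sub>m T' \<and> numerical_range T' \<subseteq> \<nn> \<longrightarrow> T = T')"

text \<open>For dense \<open>D\<close> the vector \<open>\<zeta>\<close> is unique.\<close>

definition associated_operator ::
    "'a::complex_hilbert_space set \<Rightarrow> ('a \<Rightarrow> 'a \<Rightarrow> complex) \<Rightarrow> 'a op"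
  where "associated_operator D \<Omega> =
    (\<lambda>\<xi>. if \<xi> \<in> D \<and> (\<exists>\<zeta>. \<forall>\<eta>\<in>D. \<Omega> \<xi> \<eta> = cinner \<zeta> \<eta>)
          then Some (THE \<zeta>. \<forall>\<eta>\<in>D. \<Omega> \<xi> \<eta> = cinner \<zeta> \<eta>) else None)"

section \<open>Strips\<close>

definition strip :: "complex set \<Rightarrow> bool"
  where "strip S \<longleftrightarrow>
    (\<exists>a (b::real) (\<alpha>::real) S\<^sub>\<alpha>. a \<noteq> 0 \<and> \<alpha> \<ge> 0 \<and>
      {z. \<bar>Im z\<bar> < \<alpha>} \<subseteq> S\<^sub>\<alpha> \<and> S\<^sub>\<alpha> \<subseteq> {z. \<bar>Im z\<bar> \<le> \<alpha>} \<and>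
      S = (\<lambda>z. a * z + complex_of_real b) ` S\<^sub>\<alpha>)"

end

theory Submission
  imports Defs
begin

text \<open>
  A point \<open>\<mu>\<close> outside the closure of the numerical range keeps a positive distance to it, so that
  \<open>T - \<mu>\<close> is bounded below. It remains to see that \<open>T - \<mu>\<close> is onto, and for this it suffices
  that \<open>T\<close> is closed and that the domain of the adjoint \<open>T*\<close> is contained in the domain of \<open>T\<close>:
  a vector \<open>\<eta>\<close> orthogonal to the range of \<open>T - \<mu>\<close> then lies in the domain of \<open>T\<close>, so it can be
  tested against \<open>(T - \<mu>) \<eta>\<close>, and \<open>\<langle>(T - \<mu>) \<eta>, \<eta>\<rangle> = 0\<close> forces \<open>\<eta> = 0\<close>
  (\<open>resolvent_outside_numerical_range\<close>). Maximality follows by comparing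
  \<open>T\<close> with an extension at a point outside the closure of the convex set (\<open>n_maximalI\<close>).

  The two properties of \<open>T\<close> have different sources. Let \<open>\<Theta> = \<Omega> + \<Upsilon>\<close> be a perturbed form for which
  every bounded conjugate-linear functional on \<open>D\<close> is \<open>\<Theta> \<xi> \<cdot>\<close> for a unique \<open>\<xi>\<close>. The solution
  \<open>\<xi>\<close>, measured in the Hilbert space, depends continuously on the functional (\<open>norm_le_q\<close>). This
  gives the closedness of \<open>T\<close>. Together with reflexivity it also gives solvability of the adjoint
  equation \<open>\<Theta> \<cdot> \<zeta> = \<langle>\<cdot>, \<psi>\<rangle>\<close> (\<open>solve_adjoint\<close>), and hence every vector in the domain of \<open>T*\<close> is in
  the form domain \<open>D\<close> (\<open>adjoint_domain\<close>). The strip is what leads from \<open>D\<close> to the domain of \<open>T\<close>: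
  after a rotation of the plane the skew part of \<open>\<Omega>\<close> is bounded in the Hilbert norm, so that
  \<open>\<Omega> \<eta> \<cdot>\<close> is continuous as soon as \<open>\<Omega> \<cdot> \<eta>\<close> is (\<open>strip_continuous_swap\<close>).

  The continuity in \<open>norm_le_q\<close> is a bounded inverse theorem between \<open>D\<close> and its conjugate dual. The
  category argument runs in the norm that \<open>\<Theta>\<close> transports from the dual to \<open>D\<close>, where
  completeness is the pointwise completeness of a dual space; sums of series in \<open>D\<close> are supplied,
  as weak sums, by reflexivity (\<open>reflexive_weak_sum\<close>).
\<close>

section \<open>Hilbert space\<close>

lemma cinner_add_right: "cinner x (y + z) = cinner x y + cinner x z"
  by (metis cinner_commute cinner_add_left complex_cnj_add)

lemma cinner_scaleC_right: "cinner x (a *\<^sub>C y) = cnj a * cinner x y"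
  by (metis cinner_commute cinner_scaleC_left complex_cnj_mult)

lemma cinner_zero_left [simp]: "cinner 0 x = 0"
  using cinner_add_left [of 0 0 x] by simp

lemma cinner_zero_right [simp]: "cinner x 0 = 0"
  using cinner_add_right [of x 0 0] by simp

lemma cinner_diff_left: "cinner (x - y) z = cinner x z - cinner y z"
  using cinner_add_left [of "x - y" y z] by simp

lemma cinner_diff_right: "cinner x (y - z) = cinner x y - cinner x z"
  using cinner_add_right [of x "y - z" z] by simp

lemma cinner_minus_right: "cinner x (- y) = - cinner x y"
  using cinner_diff_right [of x 0 y] by simp

lemma cinner_self_eq_0: "cinner x x = 0 \<longleftrightarrow> x = 0"
  by (simp add: cinner_self)

lemma norm_scaleC: "norm (a *\<^sub>C x) = cmod a * norm (x :: 'a::complex_hilbert_space)"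
proof -
  have "complex_of_real ((norm (a *\<^sub>C x))\<^sup>2) = complex_of_real ((cmod a * norm x)\<^sup>2)"
    unfolding cinner_self [symmetric] cinner_scaleC_left cinner_scaleC_right
    by (simp add: cinner_self power_mult_distrib complex_norm_square del: of_real_power)
  then have "(norm (a *\<^sub>C x))\<^sup>2 = (cmod a * norm x)\<^sup>2"
    by (simp only: of_real_eq_iff)
  then show ?thesis
    by (simp add: power2_eq_iff_nonneg)
qed

lemma norm_add_square: "(norm (x + y))\<^sup>2 = (norm x)\<^sup>2 + (norm y)\<^sup>2 + 2 * Re (cinner x y)"
proof -
  have "(norm z)\<^sup>2 = Re (cinner z z)" for z :: 'a
    by (simp add: cinner_self)
  moreover have "Re (cinner y x) = Re (cinner x y)"
    by (subst cinner_commute) simp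
  ultimately show ?thesis
    by (simp add: cinner_add_left cinner_add_right)
qed

lemma norm_diff_square: "(norm (x - y))\<^sup>2 = (norm x)\<^sup>2 + (norm y)\<^sup>2 - 2 * Re (cinner x y)"
  using norm_add_square [of "x - y" y] by (simp add: cinner_diff_left cinner_self)

lemma cinner_Cauchy_Schwarz: "cmod (cinner x y) \<le> norm x * norm y"
proof (cases "y = 0")
  case False
  define c where "c = cinner x y"
  define r where "r = (norm y)\<^sup>2"
  have r: "r > 0"
    using False by (simp add: r_def)
  \<comment> \<open>expand the squared norm of \<open>x\<close> minus its projection on \<open>y\<close>\<close>
  have "0 \<le> (norm (x - (c / of_real r) *\<^sub>C y))\<^sup>2"
    by simp
  also have "\<dots> = (norm x)\<^sup>2 + (cmod c / r)\<^sup>2 * r - 2 * Re (cnj (c / of_real r) * c)"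
    using r unfolding norm_diff_square
    by (simp add: norm_scaleC cinner_scaleC_right c_def [symmetric] power_mult_distrib
        norm_divide norm_power power_divide r_def)
  also have "cnj (c / of_real r) * c = of_real ((cmod c)\<^sup>2 / r)"
    unfolding of_real_divide complex_norm_square by simp
  finally have "0 \<le> (norm x)\<^sup>2 - (cmod c)\<^sup>2 / r"
    using r by (simp add: power2_eq_square)
  then have "(cmod c)\<^sup>2 \<le> (norm x * norm y)\<^sup>2"
    using r by (simp add: field_simps power_mult_distrib r_def)
  then show ?thesis
    by (simp add: c_def power2_le_iff_abs_le)
qed simp

lemma bounded_linear_cinner_left: "bounded_linear (\<lambda>x. cinner x y)"
  by (rule bounded_linear_intro [where K = "norm y"])
    (simp_all add: cinner_add_left scaleR_scaleC cinner_scaleC_left cinner_Cauchy_Schwarz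
      scaleC_complex_def)

lemma bounded_linear_cinner_right: "bounded_linear (cinner x)"
  by (rule bounded_linear_intro [where K = "norm x"])
    (simp_all add: cinner_add_right scaleR_scaleC cinner_scaleC_right
      cinner_Cauchy_Schwarz scaleC_complex_def mult.commute [of _ "norm x"])

lemma cinner_eqI:
  assumes "closure D = UNIV" and "\<And>\<eta>. \<eta> \<in> D \<Longrightarrow> cinner x \<eta> = cinner y \<eta>"
  shows "x = y"
proof -
  have "closed {\<eta>. cinner (x - y) \<eta> = 0}"
    by (intro closed_Collect_eq continuous_intros
        linear_continuous_on [OF bounded_linear_cinner_right])
  then have "closure D \<subseteq> {\<eta>. cinner (x - y) \<eta> = 0}"
    using assms(2) by (intro closure_minimal) (auto simp: cinner_diff_left)
  then have "cinner (x - y) (x - y) = 0"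
    using assms(1) by auto
  then show ?thesis
    by (simp add: cinner_self_eq_0)
qed

text \<open>The representing vector is the limit of a minimizing sequence of
  \<open>\<lambda>x. \<parallel>x\<parallel>\<^sup>2 - 2 Re f x\<close>: the parallelogram law makes the sequence Cauchy, and the first
  variation of the functional vanishes at the limit. As the limit lies in the closure of
  the domain, the result covers at once the representation of functionals on a dense domain and
  the orthogonal projection onto a closed subspace.\<close>

theorem Riesz_on_subspace:
  fixes f :: "'a::complex_hilbert_space \<Rightarrow> complex"
  assumes D: "complex_vector.subspace D"
    and f: "conj_linear_functional_on D f"
    and bound: "\<And>x. x \<in> D \<Longrightarrow> cmod (f x) \<le> M * norm x"
  obtains \<zeta> where "\<zeta> \<in> closure D" and "\<And>\<eta>. \<eta> \<in> D \<Longrightarrow> f \<eta> = cinner \<zeta> \<eta>"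
proof -
  have fadd: "f (x + y) = f x + f y" if "x \<in> D" "y \<in> D" for x y
    using f that by (simp add: conj_linear_functional_on_def)
  have fscale: "f (c *\<^sub>C x) = cnj c * f x" if "x \<in> D" for c x
    using f that by (simp add: conj_linear_functional_on_def)
  note Dscale = complex_vector.subspace_scale [OF D]
  note Dadd = complex_vector.subspace_add [OF D]
  define J where "J = (\<lambda>x. (norm x)\<^sup>2 - 2 * Re (f x))"
  define m where "m = Inf (J ` D)"
  have J_lower: "- M\<^sup>2 \<le> J x" if "x \<in> D" for x
  proof -
    have "Re (f x) \<le> M * norm x"
      using bound [OF that] complex_Re_le_cmod order_trans by blast
    moreover have "0 \<le> (norm x - M)\<^sup>2"
      by simp
    ultimately show ?thesis
      unfolding J_def power2_diff by (simp add: algebra_simps)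
  qed
  have bdd: "bdd_below (J ` D)"
    using J_lower by (auto intro!: bdd_belowI)
  have m_le: "m \<le> J x" if "x \<in> D" for x
    unfolding m_def by (rule cInf_lower [OF _ bdd]) (use that in auto)
  have "D \<noteq> {}"
    using complex_vector.subspace_0 [OF D] by auto
  have "\<exists>x\<in>D. J x < m + 1 / (real n + 1)" for n
  proof -
    have "Inf (J ` D) < m + 1 / (real n + 1)"
      unfolding m_def by simp
    then show ?thesis
      using cInf_lessD [of "J ` D"] \<open>D \<noteq> {}\<close> by blast
  qed
  then obtain x where xD: "\<And>n. x n \<in> D" and xJ: "\<And>n. J (x n) < m + 1 / (real n + 1)"
    by metis
  have parallelogram: "(norm (u - v))\<^sup>2 \<le> 2 * (J u - m) + 2 * (J v - m)"
    if u: "u \<in> D" and v: "v \<in> D" for u v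
  proof -
    define w where "w = complex_of_real (1/2) *\<^sub>C (u + v)"
    have "w \<in> D"
      unfolding w_def by (intro Dscale Dadd u v)
    have "f w = complex_of_real (1/2) * (f u + f v)"
      using fscale [OF Dadd [OF u v], of "complex_of_real (1/2)"] fadd [OF u v]
      by (simp add: w_def)
    then have "2 * f w = f u + f v"
      by (simp add: mult.commute)
    then have "2 * Re (f w) = Re (f u) + Re (f v)"
      by (metis mult_2 plus_complex.sel(1))
    moreover have "norm (u + v) = 2 * norm w"
      unfolding w_def norm_scaleC by simp
    ultimately have "4 * J w = (norm (u + v))\<^sup>2 - 4 * Re (f u) - 4 * Re (f v)"
      unfolding J_def by (simp add: power_mult_distrib)
    then have "(norm (u - v))\<^sup>2 = 2 * J u + 2 * J v - 4 * J w"
      unfolding J_def norm_add_square norm_diff_square by simp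
    with m_le [OF \<open>w \<in> D\<close>] show ?thesis
      by simp
  qed
  have "Cauchy x"
  proof (rule metric_CauchyI)
    fix e :: real
    assume e: "e > 0"
    obtain K :: nat where K: "4 / e\<^sup>2 < real K"
      using reals_Archimedean2 by blast
    have small: "J (x n) - m < e\<^sup>2 / 4" if "n \<ge> K" for n
    proof -
      have "4 / e\<^sup>2 < real n + 1"
        using K that by linarith
      then have "1 / (real n + 1) < e\<^sup>2 / 4"
        using e by (simp add: field_simps)
      with xJ [of n] show ?thesis
        by simp
    qed
    have "dist (x i) (x j) < e" if "i \<ge> K" "j \<ge> K" for i j
    proof -
      have "(norm (x i - x j))\<^sup>2 < e\<^sup>2"
        using parallelogram [OF xD [of i] xD [of j]] small [OF that(1)] small [OF that(2)]
        by (simp add: field_simps)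
      then show ?thesis
        using e by (simp add: dist_norm power2_less_imp_less)
    qed
    then show "\<exists>K. \<forall>i\<ge>K. \<forall>j\<ge>K. dist (x i) (x j) < e"
      by blast
  qed
  then obtain \<zeta> where \<zeta>: "x \<longlonglongrightarrow> \<zeta>"
    using Cauchy_convergent_iff convergent_def by blast
  have J_lim: "(\<lambda>n. J (x n)) \<longlonglongrightarrow> m"
  proof (rule tendsto_sandwich)
    show "\<forall>\<^sub>F n in sequentially. m \<le> J (x n)"
      using m_le xD by simp
    show "\<forall>\<^sub>F n in sequentially. J (x n) \<le> m + inverse (real (Suc n))"
      using xJ by (intro always_eventually allI less_imp_le) (simp add: inverse_eq_divide add.commute)
    show "(\<lambda>n. m + inverse (real (Suc n))) \<longlonglongrightarrow> m"
      using tendsto_add [OF tendsto_const LIMSEQ_inverse_real_of_nat, of m] by simp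
  qed simp
  have Re_zero: "Re (cinner \<zeta> \<eta> - f \<eta>) = 0" if \<eta>: "\<eta> \<in> D" for \<eta>
  proof -
    \<comment> \<open>first and second order coefficients of the functional along the line in direction \<open>\<eta>\<close>\<close>
    define a where "a = Re (cinner \<zeta> \<eta> - f \<eta>)"
    define b where "b = (norm \<eta>)\<^sup>2"
    have var: "0 \<le> 2 * t * a + t\<^sup>2 * b" for t :: real
    proof -
      have "m \<le> J (x n) + 2 * t * Re (cinner (x n) \<eta> - f \<eta>) + t\<^sup>2 * b" for n
      proof -
        have "x n + complex_of_real t *\<^sub>C \<eta> \<in> D"
          by (intro Dadd Dscale xD \<eta>)
        then have "m \<le> J (x n + complex_of_real t *\<^sub>C \<eta>)"
          by (rule m_le)
        also have "\<dots> = J (x n) + 2 * t * Re (cinner (x n) \<eta> - f \<eta>) + t\<^sup>2 * b"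
          unfolding J_def norm_add_square b_def
          by (simp add: fadd xD Dscale \<eta> fscale norm_scaleC cinner_scaleC_right
              power_mult_distrib algebra_simps)
        finally show ?thesis .
      qed
      moreover have "(\<lambda>n. J (x n) + 2 * t * Re (cinner (x n) \<eta> - f \<eta>) + t\<^sup>2 * b)
          \<longlonglongrightarrow> m + 2 * t * a + t\<^sup>2 * b"
        unfolding a_def
        by (intro tendsto_intros J_lim bounded_linear.tendsto [OF bounded_linear_cinner_left] \<zeta>)
      ultimately have "m \<le> m + 2 * t * a + t\<^sup>2 * b"
        by (intro LIMSEQ_le_const) auto
      then show ?thesis
        by simp
    qed
    have b: "b \<ge> 0"
      by (simp add: b_def)
    \<comment> \<open>a step of length \<open>- a / (b + 1)\<close> decreases the functional unless \<open>a = 0\<close>; the summand \<open>1\<close>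
      keeps the denominator away from zero\<close>
    have eq: "2 * (- a / (b + 1)) * a + (- a / (b + 1))\<^sup>2 * b = - (a\<^sup>2 * (b + 2)) / (b + 1)\<^sup>2"
      using b by (simp add: divide_simps power2_eq_square) (simp add: algebra_simps)
    have "0 \<le> - (a\<^sup>2 * (b + 2)) / (b + 1)\<^sup>2"
      using var [of "- a / (b + 1)"] by (simp only: eq)
    moreover have "(b + 1)\<^sup>2 > 0"
      using b by simp
    ultimately have "a\<^sup>2 * (b + 2) \<le> 0"
      by (simp only: zero_le_divide_iff) linarith
    then have "a = 0"
      using b by (simp add: mult_le_0_iff)
    then show ?thesis
      by (simp add: a_def)
  qed
  \<comment> \<open>the direction \<open>\<i> \<eta>\<close> gives the imaginary part\<close>
  have "f \<eta> = cinner \<zeta> \<eta>" if \<eta>: "\<eta> \<in> D" for \<eta>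
  proof -
    have "Re (cinner \<zeta> (\<i> *\<^sub>C \<eta>) - f (\<i> *\<^sub>C \<eta>)) = 0"
      by (rule Re_zero [OF Dscale [OF \<eta>]])
    then have "Im (cinner \<zeta> \<eta> - f \<eta>) = 0"
      by (simp add: fscale \<eta> cinner_scaleC_right)
    with Re_zero [OF \<eta>] show ?thesis
      by (simp add: complex_eq_iff)
  qed
  moreover have "\<zeta> \<in> closure D"
    using \<zeta> xD closure_sequential by blast
  ultimately show ?thesis
    using that by blast
qed

text \<open>The representing vector of \<open>cinner y\<close> on the subspace is the projection of \<open>y\<close> onto its
  closure.\<close>

lemma dense_if_orthogonal_trivial:
  fixes R :: "'a::complex_hilbert_space set"
  assumes R: "complex_vector.subspace R"
    and trivial: "\<And>\<eta>. (\<And>x. x \<in> R \<Longrightarrow> cinner x \<eta> = 0) \<Longrightarrow> \<eta> = 0"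
  shows "closure R = UNIV"
proof -
  have "y \<in> closure R" for y
  proof -
    have "conj_linear_functional_on R (cinner y)"
      by (simp add: conj_linear_functional_on_def cinner_add_right cinner_scaleC_right)
    then obtain \<zeta> where \<zeta>: "\<zeta> \<in> closure R" "\<And>x. x \<in> R \<Longrightarrow> cinner y x = cinner \<zeta> x"
      using Riesz_on_subspace [OF R _ cinner_Cauchy_Schwarz] by blast
    have "y - \<zeta> = 0"
    proof (rule trivial)
      fix x
      assume "x \<in> R"
      then have "cinner (y - \<zeta>) x = 0"
        using \<zeta>(2) by (simp add: cinner_diff_left)
      then show "cinner x (y - \<zeta>) = 0"
        by (metis cinner_commute complex_cnj_zero)
    qed
    with \<zeta>(1) show ?thesis
      by simp
  qed
  then show ?thesis
    by blast
qed


section \<open>Dual norms and reflexivity\<close>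

lemma norm_on_zero: "complex_vector.subspace V \<Longrightarrow> norm_on V N \<Longrightarrow> N 0 = 0"
  by (simp add: norm_on_def complex_vector.subspace_0)

lemma norm_on_diff_commute:
  assumes "complex_vector.subspace V" "norm_on V N" "x \<in> V" "y \<in> V"
  shows "N (x - y) = N (y - x)"
proof -
  have "y - x \<in> V"
    using assms by (simp add: complex_vector.subspace_diff)
  then have "N ((-1) *\<^sub>C (y - x)) = cmod (-1) * N (y - x)"
    using assms(2) unfolding norm_on_def by blast
  moreover have "(-1) *\<^sub>C (y - x) = x - y"
    using complex_vector.scale_minus_left [of 1 "y - x"] by (simp add: scaleC_one)
  ultimately show ?thesis
    by simp
qed

lemma norm_on_triangle_sub:
  assumes "complex_vector.subspace V" "norm_on V N" "x \<in> V" "y \<in> V" "z \<in> V"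
  shows "N (x - z) \<le> N (x - y) + N (y - z)"
proof -
  have "N ((x - y) + (y - z)) \<le> N (x - y) + N (y - z)"
    using assms unfolding norm_on_def by (blast intro: complex_vector.subspace_diff)
  then show ?thesis
    by simp
qed

lemma norm_on_triangle_diff:
  assumes "complex_vector.subspace V" "norm_on V N" "x \<in> V" "y \<in> V"
  shows "N (x - y) \<le> N x + N y"
  using norm_on_triangle_sub [OF assms(1-3) complex_vector.subspace_0 [OF assms(1)] assms(4)]
    norm_on_diff_commute [OF assms(1,2) assms(4) complex_vector.subspace_0 [OF assms(1)]]
  by simp

lemma bdd_above_dual_norm:
  assumes N: "norm_on V N" and f: "bounded_functional_on V N f"
  shows "bdd_above ((\<lambda>x. cmod (f x)) ` {x \<in> V. N x \<le> 1})"
proof -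
  obtain M where M: "\<And>x. x \<in> V \<Longrightarrow> cmod (f x) \<le> M * N x"
    using f unfolding bounded_functional_on_def by blast
  have "cmod (f x) \<le> \<bar>M\<bar>" if "x \<in> V" "N x \<le> 1" for x
  proof -
    have "M * N x \<le> \<bar>M\<bar> * 1"
      using that N by (intro mult_mono) (auto simp: norm_on_def)
    with M [OF that(1)] show ?thesis
      by simp
  qed
  then show ?thesis
    by (intro bdd_aboveI [where M = "\<bar>M\<bar>"]) auto
qed

text \<open>The hypothesis on \<open>f\<close> is what linear and conjugate-linear functionals have in common, so
  that one lemma serves both kinds of dual space.\<close>

lemma dual_norm_bound:
  assumes V: "complex_vector.subspace V" and N: "norm_on V N"
    and hom: "\<And>c x. x \<in> V \<Longrightarrow> cmod (f (c *\<^sub>C x)) = cmod c * cmod (f x)"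
    and bdd: "bounded_functional_on V N f" and x: "x \<in> V"
  shows "cmod (f x) \<le> dual_norm_on V N f * N x"
proof (cases "x = 0")
  case True
  then have "cmod (f x) = 0"
    using hom [OF x, of 0] by (simp add: complex_vector.scale_zero_left)
  with True norm_on_zero [OF V N] show ?thesis
    by simp
next
  case False
  then have Nx: "N x > 0"
    using N x unfolding norm_on_def by (metis less_eq_real_def)
  define y where "y = complex_of_real (inverse (N x)) *\<^sub>C x"
  have "y \<in> V"
    unfolding y_def by (intro complex_vector.subspace_scale V x)
  moreover have "N y = 1"
  proof -
    have "N y = cmod (complex_of_real (inverse (N x))) * N x"
      using N x unfolding norm_on_def y_def by blast
    then show ?thesis
      using Nx by (simp del: of_real_inverse)
  qed
  ultimately have "cmod (f y) \<le> dual_norm_on V N f"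
    unfolding dual_norm_on_def by (intro cSUP_upper bdd_above_dual_norm N bdd) auto
  moreover have "cmod (f y) = inverse (N x) * cmod (f x)"
    unfolding y_def hom [OF x] using Nx by (simp del: of_real_inverse)
  ultimately show ?thesis
    using Nx by (simp add: field_simps)
qed

lemma dual_norm_le:
  assumes V: "complex_vector.subspace V" and N: "norm_on V N" and "B \<ge> 0"
    and B: "\<And>x. x \<in> V \<Longrightarrow> cmod (f x) \<le> B * N x"
  shows "dual_norm_on V N f \<le> B"
  unfolding dual_norm_on_def
proof (rule cSUP_least)
  show "{x \<in> V. N x \<le> 1} \<noteq> {}"
    using complex_vector.subspace_0 [OF V] norm_on_zero [OF V N] by force
  show "cmod (f x) \<le> B" if "x \<in> {x \<in> V. N x \<le> 1}" for x
    using B [of x] mult_left_le [of "N x" B] \<open>B \<ge> 0\<close> that by auto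
qed

lemma dual_norm_nonneg:
  assumes V: "complex_vector.subspace V" and N: "norm_on V N"
    and "bounded_functional_on V N f"
  shows "0 \<le> dual_norm_on V N f"
proof -
  have "cmod (f 0) \<le> dual_norm_on V N f"
    unfolding dual_norm_on_def
    by (intro cSUP_upper bdd_above_dual_norm assms)
      (simp add: complex_vector.subspace_0 [OF V] norm_on_zero [OF V N])
  then show ?thesis
    using norm_ge_zero order_trans by blast
qed

lemma scaleC_apply [simp]: "(c *\<^sub>C f) x = c * (f x :: complex)"
  by (simp add: scaleC_fun_def scaleC_complex_def)

lemma dual_on_bound:
  assumes "complex_vector.subspace V" "norm_on V N" "f \<in> dual_on V N" "x \<in> V"
  shows "cmod (f x) \<le> dual_norm_on V N f * N x"
  using assms by (intro dual_norm_bound) (auto simp: dual_on_def linear_functional_on_def norm_mult)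

lemma dual_on_add:
  assumes "f \<in> dual_on V N" "g \<in> dual_on V N"
  shows "f + g \<in> dual_on V N"
proof -
  obtain L M where "\<And>x. x \<in> V \<Longrightarrow> cmod (f x) \<le> L * N x" "\<And>x. x \<in> V \<Longrightarrow> cmod (g x) \<le> M * N x"
    using assms unfolding dual_on_def bounded_functional_on_def by blast
  then have "\<And>x. x \<in> V \<Longrightarrow> cmod (f x + g x) \<le> (L + M) * N x"
    by (metis add_mono norm_triangle_le distrib_right)
  then have "bounded_functional_on V N (f + g)"
    unfolding bounded_functional_on_def plus_fun_apply by blast
  then show ?thesis
    using assms by (simp add: dual_on_def linear_functional_on_def algebra_simps)
qed

lemma dual_on_scaleC:
  assumes "f \<in> dual_on V N"
  shows "c *\<^sub>C f \<in> dual_on V N"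
proof -
  obtain L where "\<And>x. x \<in> V \<Longrightarrow> cmod (f x) \<le> L * N x"
    using assms unfolding dual_on_def bounded_functional_on_def by blast
  then have "\<And>x. x \<in> V \<Longrightarrow> cmod (c * f x) \<le> (cmod c * L) * N x"
    by (simp add: norm_mult mult.assoc mult_left_mono)
  then have "bounded_functional_on V N (c *\<^sub>C f)"
    unfolding bounded_functional_on_def scaleC_apply by blast
  then show ?thesis
    using assms
    by (simp add: dual_on_def linear_functional_on_def algebra_simps)
qed

lemma dual_onI:
  assumes "complex_vector.subspace V" and "linear_functional_on V f"
    and "\<And>x. x \<in> V \<Longrightarrow> cmod (f x) \<le> K * N x"
  shows "(\<lambda>x. if x \<in> V then f x else 0) \<in> dual_on V N"
  using assms
  by (auto simp: dual_on_def linear_functional_on_def bounded_functional_on_def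
      complex_vector.subspace_add complex_vector.subspace_scale)

lemma conj_dual_onI:
  assumes "complex_vector.subspace V" and "conj_linear_functional_on V f"
    and "\<And>x. x \<in> V \<Longrightarrow> cmod (f x) \<le> K * N x"
  shows "(\<lambda>x. if x \<in> V then f x else 0) \<in> conj_dual_on V N"
  using assms
  by (auto simp: conj_dual_on_def conj_linear_functional_on_def bounded_functional_on_def
      complex_vector.subspace_add complex_vector.subspace_scale)

text \<open>Elements of the bidual are functions that vanish outside the dual; here \<open>\<Phi>\<close> may have arbitrary
  values there, which suits functionals given by a formula.\<close>

lemma reflexive_evaluation:
  assumes "reflexive_on V N"
    and add: "\<And>f g. f \<in> dual_on V N \<Longrightarrow> g \<in> dual_on V N \<Longrightarrow> \<Phi> (f + g) = \<Phi> f + \<Phi> g"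
    and scale: "\<And>c f. f \<in> dual_on V N \<Longrightarrow> \<Phi> (c *\<^sub>C f) = c * \<Phi> f"
    and bound: "\<And>f. f \<in> dual_on V N \<Longrightarrow> cmod (\<Phi> f) \<le> K * dual_norm_on V N f"
  obtains x where "x \<in> V" and "\<And>f. f \<in> dual_on V N \<Longrightarrow> \<Phi> f = f x"
proof -
  define \<Psi> where "\<Psi> = (\<lambda>f. if f \<in> dual_on V N then \<Phi> f else 0)"
  have "\<Psi> \<in> dual_on (dual_on V N) (dual_norm_on V N)"
    unfolding \<Psi>_def dual_on_def [of "dual_on V N"]
    using bound
    by (auto simp: linear_functional_on_def bounded_functional_on_def add scale
        dual_on_add dual_on_scaleC)
  then obtain x where "x \<in> V" "\<And>f. f \<in> dual_on V N \<Longrightarrow> \<Psi> f = f x"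
    using assms(1) unfolding reflexive_on_def by blast
  then show ?thesis
    using that by (simp add: \<Psi>_def)
qed

text \<open>In a reflexive space an absolutely convergent series converges weakly: summing a functional
  over its terms is an element of the bidual.\<close>

lemma reflexive_weak_sum:
  fixes u :: "nat \<Rightarrow> 'v::complex_vector"
  assumes V: "complex_vector.subspace V" and N: "norm_on V N" and refl: "reflexive_on V N"
    and u: "\<And>k. u k \<in> V" and a: "\<And>k. N (u k) \<le> a k" and "summable a"
  obtains s where "s \<in> V" and "\<And>f. f \<in> dual_on V N \<Longrightarrow> (\<lambda>k. f (u k)) sums f s"
proof -
  have le: "cmod (f (u k)) \<le> dual_norm_on V N f * a k" if "f \<in> dual_on V N" for f k
  proof -
    have "0 \<le> dual_norm_on V N f"
      using that by (intro dual_norm_nonneg V N) (simp add: dual_on_def)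
    then show ?thesis
      using dual_on_bound [OF V N that u] a mult_left_mono order_trans by blast
  qed
  have summ: "summable (\<lambda>k. f (u k))" if "f \<in> dual_on V N" for f
    by (rule summable_comparison_test [OF _ summable_mult [OF \<open>summable a\<close>]])
      (use le [OF that] in blast)
  obtain s where "s \<in> V" and s: "\<And>f. f \<in> dual_on V N \<Longrightarrow> (\<Sum>k. f (u k)) = f s"
  proof (rule reflexive_evaluation [OF refl])
    show "(\<Sum>k. (f + g) (u k)) = (\<Sum>k. f (u k)) + (\<Sum>k. g (u k))"
      if "f \<in> dual_on V N" "g \<in> dual_on V N" for f g
      using suminf_add [OF summ summ] that by simp
    show "(\<Sum>k. (c *\<^sub>C f) (u k)) = c * (\<Sum>k. f (u k))" if "f \<in> dual_on V N" for c f
      using suminf_mult [OF summ] that by simp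
    show "cmod (\<Sum>k. f (u k)) \<le> suminf a * dual_norm_on V N f" if "f \<in> dual_on V N" for f
    proof -
      have "summable (\<lambda>k. dual_norm_on V N f * a k)"
        by (rule summable_mult [OF \<open>summable a\<close>])
      then have "cmod (\<Sum>k. f (u k)) \<le> (\<Sum>k. dual_norm_on V N f * a k)"
        by (intro norm_suminf_le le that)
      then show ?thesis
        using suminf_mult [OF \<open>summable a\<close>, of "dual_norm_on V N f"] by (simp add: mult.commute)
    qed
  qed blast
  show ?thesis
    using that [OF \<open>s \<in> V\<close>] s summ by (metis summable_sums)
qed

section \<open>Approximate solutions from the Baire category theorem\<close>

text \<open>The sets \<open>{x. N x \<le> n}\<close> cover \<open>V\<close>, so the \<open>q\<close>-closure of one of them contains a \<open>q\<close>-ball.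
  After translation to the origin and scaling, every vector is approximated in \<open>q\<close> up to half its
  size by a vector controlled in \<open>N\<close>; iterating on the remainder gives a series that is absolutely
  convergent for \<open>N\<close> and has sum \<open>y\<close> for \<open>q\<close>.\<close>

lemma geometric_decomposition:
  fixes V :: "'v::complex_vector set"
  assumes V: "complex_vector.subspace V" and N: "norm_on V N" and q: "norm_on V q"
    and complete: "\<And>x :: nat \<Rightarrow> 'v. (\<And>n. x n \<in> V) \<Longrightarrow>
      (\<And>e. e > 0 \<Longrightarrow> \<exists>K. \<forall>m\<ge>K. \<forall>n\<ge>K. q (x m - x n) < e) \<Longrightarrow>
      \<exists>l\<in>V. (\<lambda>n. q (x n - l)) \<longlonglongrightarrow> 0"
  obtains C where "C \<ge> 0" and "\<And>y. y \<in> V \<Longrightarrow> \<exists>u. \<forall>k. u k \<in> V \<and>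
    N (u k) \<le> C * q y * (1/2) ^ k \<and> q (y - (\<Sum>i<k. u i)) \<le> q y * (1/2) ^ k"
proof -
  note [intro] = complex_vector.subspace_diff [OF V] complex_vector.subspace_scale [OF V]
    complex_vector.subspace_0 [OF V] complex_vector.subspace_add [OF V]
  \<comment> \<open>\<open>q\<close> is a norm only on \<open>V\<close>, whereas a distance is nonnegative and symmetric on the whole type\<close>
  define d where "d = (\<lambda>x y. if x \<in> V \<and> y \<in> V then q (x - y) else 0)"
  interpret Metric_space V d
  proof
    show "0 \<le> d x y" for x y
      using q by (auto simp: d_def norm_on_def)
    show "d x y = d y x" for x y
      using norm_on_diff_commute [OF V q] by (auto simp: d_def)
    show "(d x y = 0) = (x = y)" if "x \<in> V" "y \<in> V" for x y
    proof -
      have "x - y \<in> V"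
        using that by auto
      then have "(q (x - y) = 0) = (x - y = 0)"
        using q unfolding norm_on_def by blast
      then show ?thesis
        using that by (simp add: d_def)
    qed
    show "d x z \<le> d x y + d y z" if "x \<in> V" "y \<in> V" "z \<in> V" for x y z
      using norm_on_triangle_sub [OF V q] that by (simp add: d_def)
  qed
  have "mcomplete"
    unfolding mcomplete_def MCauchy_def limitin_metric_dist_null
  proof (intro allI impI, elim conjE)
    fix x :: "nat \<Rightarrow> 'v"
    assume x: "range x \<subseteq> V"
      and C: "\<forall>\<epsilon>>0. \<exists>K. \<forall>n n'. K \<le> n \<longrightarrow> K \<le> n' \<longrightarrow> d (x n) (x n') < \<epsilon>"
    have xV: "x n \<in> V" for n
      using x by auto
    have "\<exists>l\<in>V. (\<lambda>n. q (x n - l)) \<longlonglongrightarrow> 0"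
    proof (rule complete [OF xV])
      show "\<exists>K. \<forall>m\<ge>K. \<forall>n\<ge>K. q (x m - x n) < e" if "e > 0" for e
        using C that xV by (simp add: d_def)
    qed
    then show "\<exists>l. l \<in> V \<and> (\<forall>\<^sub>F n in sequentially. x n \<in> V) \<and> (\<lambda>n. d (x n) l) \<longlonglongrightarrow> 0"
      using xV by (auto simp: d_def)
  qed
  define A where "A = (\<lambda>n::nat. mtopology closure_of {x \<in> V. N x \<le> real n})"
  have "\<Union> (range A) = V"
  proof
    show "\<Union> (range A) \<subseteq> V"
      unfolding A_def by (auto simp: metric_closure_of)
    show "V \<subseteq> \<Union> (range A)"
    proof
      fix x
      assume x: "x \<in> V"
      obtain n :: nat where "N x \<le> real n"
        using real_arch_simple by blast
      then have "x \<in> A n"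
        unfolding A_def using x closure_of_subset [of "{x \<in> V. N x \<le> real n}" mtopology]
        by (auto simp: subset_iff)
      then show "x \<in> \<Union> (range A)"
        by blast
    qed
  qed
  then have nonempty: "mtopology interior_of \<Union> (range A) \<noteq> {}"
    using interior_of_topspace [of mtopology] complex_vector.subspace_0 [OF V] by auto
  have "\<exists>n. mtopology interior_of (A n) \<noteq> {}"
  proof (rule ccontr)
    assume "\<nexists>n. mtopology interior_of (A n) \<noteq> {}"
    then have "mtopology interior_of \<Union> (range A) = {}"
      by (intro metric_Baire_category_alt [OF \<open>mcomplete\<close>]) (auto simp: A_def)
    with nonempty show False
      by contradiction
  qed
  then obtain n where "mtopology interior_of (A n) \<noteq> {}"
    by blast
  then obtain x0 where x0: "x0 \<in> mtopology interior_of (A n)"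
    by blast
  then obtain r where r: "r > 0" and ball: "mball x0 r \<subseteq> A n"
    by (metis openin_interior_of openin_mtopology interior_of_subset order_trans)
  have x0V: "x0 \<in> V"
    using x0 interior_of_subset [of mtopology "A n"] by (auto simp: A_def metric_closure_of)
  have approx: "\<exists>v\<in>V. N v \<le> real n \<and> q (x - v) < r / 8" if "x \<in> V" "q (x0 - x) < r" for x
  proof -
    have "d x0 x < r"
      using that x0V by (simp add: d_def)
    then have "x \<in> A n"
      using ball that x0V by auto
    moreover have "r / 8 > 0"
      using r by simp
    ultimately obtain v where v: "v \<in> V" "N v \<le> real n" "v \<in> mball x (r / 8)"
      unfolding A_def metric_closure_of by blast
    then have "d x v < r / 8"
      by simp
    then show ?thesis
      using v that by (auto simp: d_def)
  qed
  define C where "C = 4 * real n / r"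
  have step: "\<exists>u\<in>V. N u \<le> C * q y \<and> q (y - u) \<le> q y / 2" if y: "y \<in> V" for y
  proof (cases "y = 0")
    case True
    then show ?thesis
      by (intro bexI [of _ 0]) (auto simp: norm_on_zero [OF V N] norm_on_zero [OF V q])
  next
    case False
    then have qy: "q y > 0"
      using q y unfolding norm_on_def by (metis less_eq_real_def)
    \<comment> \<open>scale \<open>y\<close> to half the radius of the ball; the two errors \<open>r / 8\<close> at the end points of the
      translated vector add up to half of that\<close>
    define t where "t = r / (2 * q y)"
    have t: "t > 0"
      using r qy by (simp add: t_def)
    define y' where "y' = complex_of_real t *\<^sub>C y"
    have y': "y' \<in> V"
      unfolding y'_def using y by blast
    have "q y' = cmod (complex_of_real t) * q y"
      unfolding y'_def using q y norm_on_def by blast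
    also have "\<dots> = t * q y"
      using t by simp
    also have "\<dots> = r / 2"
      using qy by (simp add: t_def)
    finally have "q y' = r / 2" .
    moreover have "q (x0 - (x0 + y')) = q y'"
      using norm_on_diff_commute [OF V q y', of 0] complex_vector.subspace_0 [OF V] by simp
    ultimately have "q (x0 - (x0 + y')) < r"
      using r by simp
    then obtain v1 where v1: "v1 \<in> V" "N v1 \<le> real n" "q (x0 + y' - v1) < r / 8"
      using approx [of "x0 + y'"] x0V y' by blast
    have "q (x0 - x0) < r"
      using r by (simp add: norm_on_zero [OF V q])
    then obtain v2 where v2: "v2 \<in> V" "N v2 \<le> real n" "q (x0 - v2) < r / 8"
      using approx x0V by blast
    define u' where "u' = v1 - v2"
    have u': "u' \<in> V"
      unfolding u'_def using v1 v2 by blast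
    have Nu': "N u' \<le> 2 * real n"
      unfolding u'_def using norm_on_triangle_diff [OF V N v1(1) v2(1)] v1 v2 by simp
    have "q ((x0 + y' - v1) - (x0 - v2)) \<le> q (x0 + y' - v1) + q (x0 - v2)"
      using x0V y' v1 v2 by (intro norm_on_triangle_diff [OF V q]) auto
    moreover have "(x0 + y' - v1) - (x0 - v2) = y' - u'"
      by (simp add: u'_def)
    ultimately have qu': "q (y' - u') \<le> r / 4"
      using v1 v2 by simp
    define u where "u = complex_of_real (1/t) *\<^sub>C u'"
    have "y = complex_of_real (1/t) *\<^sub>C y'"
      using t by (simp add: y'_def scaleC_scaleC scaleC_one)
    then have "y - u = complex_of_real (1/t) *\<^sub>C (y' - u')"
      by (simp add: u_def complex_vector.scale_right_diff_distrib)
    moreover have "q (complex_of_real (1/t) *\<^sub>C (y' - u')) = cmod (complex_of_real (1/t)) * q (y' - u')"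
      using q u' y' complex_vector.subspace_diff [OF V] unfolding norm_on_def by blast
    ultimately have "q (y - u) = q (y' - u') / t"
      using t by (simp add: norm_divide)
    also have "\<dots> \<le> (r / 4) / t"
      using qu' t by (intro divide_right_mono) auto
    also have "\<dots> = q y / 2"
      using r qy by (simp add: t_def)
    finally have "q (y - u) \<le> q y / 2" .
    have "N u = cmod (complex_of_real (1/t)) * N u'"
      using N u' unfolding norm_on_def u_def by blast
    then have "N u = N u' / t"
      using t by (simp add: norm_divide)
    also have "\<dots> \<le> 2 * real n / t"
      using Nu' t by (intro divide_right_mono) auto
    also have "\<dots> = C * q y"
      using r qy by (simp add: t_def C_def)
    finally have "N u \<le> C * q y" .
    moreover have "u \<in> V"
      unfolding u_def using u' by blast
    ultimately show ?thesis
      using \<open>q (y - u) \<le> q y / 2\<close> by blast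
  qed
  have C: "C \<ge> 0"
    using r by (simp add: C_def)
  obtain g where g: "\<And>y. y \<in> V \<Longrightarrow> g y \<in> V" "\<And>y. y \<in> V \<Longrightarrow> N (g y) \<le> C * q y"
    "\<And>y. y \<in> V \<Longrightarrow> q (y - g y) \<le> q y / 2"
    using step by metis
  have "\<exists>u. \<forall>k. u k \<in> V \<and> N (u k) \<le> C * q y * (1/2) ^ k \<and>
      q (y - (\<Sum>i<k. u i)) \<le> q y * (1/2) ^ k" if y: "y \<in> V" for y
  proof -
    \<comment> \<open>remainders of the successive approximations\<close>
    define z where "z = rec_nat y (\<lambda>_ v. v - g v)"
    have z0: "z 0 = y" and zS: "z (Suc k) = z k - g (z k)" for k
      by (simp_all add: z_def)
    have zV: "z k \<in> V" for k
      by (induction k) (use y g in \<open>auto simp: z0 zS\<close>)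
    have qz: "q (z k) \<le> q y * (1/2) ^ k" for k
    proof (induction k)
      case (Suc k)
      then show ?case
        using g(3) [OF zV [of k]] by (simp add: zS)
    qed (simp add: z0)
    have sum: "y - (\<Sum>i<k. g (z i)) = z k" for k
      by (induction k) (simp_all add: z0 zS algebra_simps)
    have "N (g (z k)) \<le> C * q y * (1/2) ^ k" for k
      using g(2) [OF zV [of k]] mult_left_mono [OF qz [of k] C] by (simp add: mult.assoc)
    then show ?thesis
      using g(1) zV qz by (intro exI [of _ "\<lambda>k. g (z k)"]) (simp add: sum)
  qed
  with C show ?thesis
    using that by blast
qed


section \<open>Nondegenerate pairings on a reflexive space\<close>

text \<open>The perturbed form of a solvable form identifies the reflexive space \<open>V\<close> with its conjugate
  dual. The pairing is studied by itself, since everything about it is about the identification and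
  not about the operator.\<close>

locale reflexive_pairing =
  fixes V :: "'a::complex_hilbert_space set" and N :: "'a \<Rightarrow> real"
    and \<Theta> :: "'a \<Rightarrow> 'a \<Rightarrow> complex" and \<alpha> \<beta> :: real
  assumes V: "complex_vector.subspace V" and N: "norm_on V N" and refl: "reflexive_on V N"
    and embed: "x \<in> V \<Longrightarrow> norm x \<le> \<alpha> * N x" and \<alpha>: "\<alpha> > 0"
    and sesq: "sesquilinear_on V \<Theta>"
    and bounded: "\<lbrakk>x \<in> V; y \<in> V\<rbrakk> \<Longrightarrow> cmod (\<Theta> x y) \<le> \<beta> * N x * N y"
    and nondegenerate: "\<lbrakk>x \<in> V; \<And>y. y \<in> V \<Longrightarrow> \<Theta> x y = 0\<rbrakk> \<Longrightarrow> x = 0"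
    and onto: "\<Lambda> \<in> conj_dual_on V N \<Longrightarrow> \<exists>x\<in>V. \<forall>y\<in>V. \<Lambda> y = \<Theta> x y"
begin

lemma add_left: "\<lbrakk>x \<in> V; x' \<in> V; y \<in> V\<rbrakk> \<Longrightarrow> \<Theta> (x + x') y = \<Theta> x y + \<Theta> x' y"
  using sesq by (simp add: sesquilinear_on_def linear_functional_on_def)

lemma scale_left: "\<lbrakk>x \<in> V; y \<in> V\<rbrakk> \<Longrightarrow> \<Theta> (c *\<^sub>C x) y = c * \<Theta> x y"
  using sesq by (simp add: sesquilinear_on_def linear_functional_on_def)

lemma diff_left:
  assumes "x \<in> V" "x' \<in> V" "y \<in> V"
  shows "\<Theta> (x - x') y = \<Theta> x y - \<Theta> x' y"
  using add_left [of "x - x'" x' y] assms by (simp add: complex_vector.subspace_diff [OF V])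

lemma sum_left:
  assumes "\<And>k. u k \<in> V" "y \<in> V"
  shows "\<Theta> (\<Sum>i<(k::nat). u i) y = (\<Sum>i<k. \<Theta> (u i) y)"
proof (induction k)
  case 0
  show ?case
    using scale_left [of 0 y 0] assms complex_vector.subspace_0 [OF V]
    by (simp add: complex_vector.scale_zero_left)
next
  case (Suc k)
  then show ?case
    using assms by (simp add: add_left complex_vector.subspace_sum [OF V])
qed

lemma conj_linear_right: "x \<in> V \<Longrightarrow> conj_linear_functional_on V (\<Theta> x)"
  using sesq by (simp add: sesquilinear_on_def)

lemma eqI:
  assumes "x \<in> V" "x' \<in> V" and "\<And>y. y \<in> V \<Longrightarrow> \<Theta> x y = \<Theta> x' y"
  shows "x = x'"
  using nondegenerate [of "x - x'"] assms
  by (simp add: diff_left complex_vector.subspace_diff [OF V])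

lemma solve:
  assumes "conj_linear_functional_on V \<Lambda>" and "\<And>y. y \<in> V \<Longrightarrow> cmod (\<Lambda> y) \<le> K * N y"
  obtains x where "x \<in> V" "\<And>y. y \<in> V \<Longrightarrow> \<Theta> x y = \<Lambda> y"
  using onto [OF conj_dual_onI [OF V assms]] by force

text \<open>The norm of the conjugate dual, transported to \<open>V\<close>.\<close>

definition q :: "'a \<Rightarrow> real"
  where "q x = dual_norm_on V N (\<Theta> x)"

lemma bounded_functional: "x \<in> V \<Longrightarrow> bounded_functional_on V N (\<Theta> x)"
  using bounded unfolding bounded_functional_on_def by blast

lemma q_nonneg: "x \<in> V \<Longrightarrow> 0 \<le> q x"
  unfolding q_def by (intro dual_norm_nonneg V N bounded_functional)

lemma q_bound:
  assumes "x \<in> V" "y \<in> V"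
  shows "cmod (\<Theta> x y) \<le> q x * N y"
  unfolding q_def
  by (rule dual_norm_bound [OF V N _ bounded_functional [OF assms(1)] assms(2)])
    (use conj_linear_right [OF assms(1)] in
      \<open>simp add: conj_linear_functional_on_def norm_mult\<close>)

lemma q_le:
  assumes "B \<ge> 0" and "\<And>y. y \<in> V \<Longrightarrow> cmod (\<Theta> x y) \<le> B * N y"
  shows "q x \<le> B"
  unfolding q_def by (rule dual_norm_le [OF V N assms])

lemma norm_on_q: "norm_on V q"
proof -
  have scale_le: "q (c *\<^sub>C x) \<le> cmod c * q x" if "x \<in> V" for c x
    using q_bound [OF that] q_nonneg [OF that] that
    by (intro q_le) (simp_all add: scale_left norm_mult mult.assoc mult_left_mono)
  have "q (c *\<^sub>C x) = cmod c * q x" if x: "x \<in> V" for c x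
  proof (cases "c = 0")
    case True
    have "0 *\<^sub>C x \<in> V"
      by (rule complex_vector.subspace_scale [OF V x])
    with True show ?thesis
      using scale_le [OF x, of 0] q_nonneg [of "0 *\<^sub>C x"] by simp
  next
    case False
    have "q x = q (inverse c *\<^sub>C c *\<^sub>C x)"
      using False by (simp add: scaleC_scaleC scaleC_one)
    also have "\<dots> \<le> inverse (cmod c) * q (c *\<^sub>C x)"
      using scale_le [OF complex_vector.subspace_scale [OF V x], of "inverse c" c]
      by (simp add: norm_inverse)
    finally have "cmod c * q x \<le> q (c *\<^sub>C x)"
      using False by (simp add: field_simps)
    with scale_le [OF x, of c] show ?thesis
      by simp
  qed
  moreover have "q (x + y) \<le> q x + q y" if "x \<in> V" "y \<in> V" for x y
  proof (rule q_le)
    show "cmod (\<Theta> (x + y) z) \<le> (q x + q y) * N z" if "z \<in> V" for z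
      using q_bound [OF \<open>x \<in> V\<close> that] q_bound [OF \<open>y \<in> V\<close> that]
        norm_triangle_ineq [of "\<Theta> x z" "\<Theta> y z"] \<open>x \<in> V\<close> \<open>y \<in> V\<close> that
      by (simp add: add_left distrib_right)
  qed (simp add: q_nonneg that)
  moreover have "q x = 0 \<longleftrightarrow> x = 0" if "x \<in> V" for x
  proof
    assume "q x = 0"
    then show "x = 0"
      using q_bound [OF that] by (intro nondegenerate that) simp
  next
    assume "x = 0"
    then have "q x = cmod 0 * q x"
      using \<open>\<And>x c. x \<in> V \<Longrightarrow> q (c *\<^sub>C x) = cmod c * q x\<close> [OF that, of 0]
      by (simp add: complex_vector.scale_zero_right)
    then show "q x = 0"
      by simp
  qed
  ultimately show ?thesis
    by (simp add: norm_on_def q_nonneg)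
qed

text \<open>The conjugate dual is complete because limits of functionals may be taken pointwise;
  solvability turns the limit functional into a vector.\<close>

lemma q_complete:
  fixes x :: "nat \<Rightarrow> 'a"
  assumes x: "\<And>n. x n \<in> V"
    and Cauchy: "\<And>e. e > 0 \<Longrightarrow> \<exists>K. \<forall>m\<ge>K. \<forall>n\<ge>K. q (x m - x n) < e"
  shows "\<exists>l\<in>V. (\<lambda>n. q (x n - l)) \<longlonglongrightarrow> 0"
proof -
  have N0: "0 \<le> N y" if "y \<in> V" for y
    using N that by (simp add: norm_on_def)
  have diff_bound: "cmod (\<Theta> (x m) y - \<Theta> (x n) y) \<le> q (x m - x n) * N y" if "y \<in> V" for m n y
    using q_bound [of "x m - x n" y] x that complex_vector.subspace_diff [OF V]
    by (simp add: diff_left)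
  have conv: "convergent (\<lambda>n. \<Theta> (x n) y)" if y: "y \<in> V" for y
    unfolding Cauchy_convergent_iff [symmetric]
  proof (rule metric_CauchyI)
    fix e :: real
    assume "e > 0"
    then have "e / (N y + 1) > 0"
      using N0 [OF y] by simp
    then obtain K where K: "\<And>m n. m \<ge> K \<Longrightarrow> n \<ge> K \<Longrightarrow> q (x m - x n) < e / (N y + 1)"
      using Cauchy by meson
    have "dist (\<Theta> (x m) y) (\<Theta> (x n) y) < e" if "m \<ge> K" "n \<ge> K" for m n
    proof -
      have "cmod (\<Theta> (x m) y - \<Theta> (x n) y) \<le> e / (N y + 1) * N y"
        using diff_bound [OF y, of m n] mult_right_mono [OF less_imp_le [OF K [OF that]] N0 [OF y]]
        by linarith
      also have "\<dots> < e"
        using \<open>e > 0\<close> N0 [OF y] by (simp add: field_simps)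
      finally show ?thesis
        by (simp add: dist_norm)
    qed
    then show "\<exists>K. \<forall>m\<ge>K. \<forall>n\<ge>K. dist (\<Theta> (x m) y) (\<Theta> (x n) y) < e"
      by blast
  qed
  define \<Lambda> where "\<Lambda> = (\<lambda>y. lim (\<lambda>n. \<Theta> (x n) y))"
  have lim: "(\<lambda>n. \<Theta> (x n) y) \<longlonglongrightarrow> \<Lambda> y" if "y \<in> V" for y
    unfolding \<Lambda>_def using conv [OF that] by (simp add: convergent_LIMSEQ_iff)
  have lim_bound: "cmod (\<Theta> (x m) y - \<Lambda> y) \<le> e * N y"
    if K: "\<And>n. n \<ge> K \<Longrightarrow> q (x m - x n) \<le> e" and y: "y \<in> V" for m K e y
  proof (rule LIMSEQ_le_const2)
    show "(\<lambda>n. cmod (\<Theta> (x m) y - \<Theta> (x n) y)) \<longlonglongrightarrow> cmod (\<Theta> (x m) y - \<Lambda> y)"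
      by (intro tendsto_intros lim y)
    have "cmod (\<Theta> (x m) y - \<Theta> (x n) y) \<le> e * N y" if "n \<ge> K" for n
      using diff_bound [OF y, of m n] mult_right_mono [OF K [OF that] N0 [OF y]] by linarith
    then show "\<exists>K. \<forall>n\<ge>K. cmod (\<Theta> (x m) y - \<Theta> (x n) y) \<le> e * N y"
      by blast
  qed
  have "conj_linear_functional_on V \<Lambda>"
    unfolding conj_linear_functional_on_def
  proof (intro conjI ballI allI)
    fix y z
    assume y: "y \<in> V" and z: "z \<in> V"
    have "(\<lambda>n. \<Theta> (x n) (y + z)) \<longlonglongrightarrow> \<Lambda> y + \<Lambda> z"
      using tendsto_add [OF lim [OF y] lim [OF z]] conj_linear_right [OF x] y z
      by (simp add: conj_linear_functional_on_def)
    then show "\<Lambda> (y + z) = \<Lambda> y + \<Lambda> z"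
      using LIMSEQ_unique lim [OF complex_vector.subspace_add [OF V y z]] by blast
  next
    fix c y
    assume y: "y \<in> V"
    have "(\<lambda>n. \<Theta> (x n) (c *\<^sub>C y)) \<longlonglongrightarrow> cnj c * \<Lambda> y"
      using tendsto_mult [OF tendsto_const lim [OF y], of "cnj c"] conj_linear_right [OF x] y
      by (simp add: conj_linear_functional_on_def)
    then show "\<Lambda> (c *\<^sub>C y) = cnj c * \<Lambda> y"
      using LIMSEQ_unique lim [OF complex_vector.subspace_scale [OF V y]] by blast
  qed
  moreover obtain m where m: "\<And>n. n \<ge> m \<Longrightarrow> q (x m - x n) \<le> 1"
    using Cauchy [of 1] by (meson less_imp_le order_refl zero_less_one)
  have "cmod (\<Lambda> y) \<le> (q (x m) + 1) * N y" if "y \<in> V" for y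
    using q_bound [OF x that, of m] lim_bound [of m m 1 y, OF m that]
      norm_triangle_ineq4 [of "\<Theta> (x m) y" "\<Theta> (x m) y - \<Lambda> y"]
    by (simp add: distrib_right)
  ultimately obtain l where l: "l \<in> V" "\<And>y. y \<in> V \<Longrightarrow> \<Theta> l y = \<Lambda> y"
    using solve by blast
  have "(\<lambda>n. q (x n - l)) \<longlonglongrightarrow> 0"
  proof (rule metric_LIMSEQ_I)
    fix e :: real
    assume "e > 0"
    then obtain K where K: "\<And>m n. m \<ge> K \<Longrightarrow> n \<ge> K \<Longrightarrow> q (x m - x n) < e / 2"
      using Cauchy half_gt_zero by meson
    have "q (x n - l) < e" if "n \<ge> K" for n
    proof -
      have "q (x n - l) \<le> e / 2"
      proof (rule q_le)
        show "cmod (\<Theta> (x n - l) y) \<le> e / 2 * N y" if "y \<in> V" for y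
          using lim_bound [of K n "e / 2" y] K [OF \<open>n \<ge> K\<close>] that
          by (simp add: diff_left x l less_imp_le)
      qed (use \<open>e > 0\<close> in simp)
      then show ?thesis
        using \<open>e > 0\<close> by simp
    qed
    moreover have "0 \<le> q (x n - l)" for n
      by (intro q_nonneg complex_vector.subspace_diff [OF V] x l)
    ultimately show "\<exists>K. \<forall>n\<ge>K. dist (q (x n - l)) 0 < e"
      by (auto simp: dist_real_def)
  qed
  with l(1) show ?thesis
    by blast
qed

text \<open>This is a bounded inverse theorem. Every \<open>y\<close> is the \<open>q\<close>-sum of a series that converges absolutely
  in \<open>N\<close>. By reflexivity the series also has a weak sum, and the functionals
  \<open>\<lambda>x. \<Theta> x \<eta>\<close> separate points and identify it with \<open>y\<close>. Testing the weak sum against the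
  inner product with \<open>y\<close> bounds \<open>\<parallel>y\<parallel>\<close>.\<close>

lemma norm_le_q:
  obtains C where "C \<ge> 0" "\<And>y. y \<in> V \<Longrightarrow> norm y \<le> C * q y"
proof -
  obtain C where C: "C \<ge> 0" and dec: "\<And>y. y \<in> V \<Longrightarrow> \<exists>u. \<forall>k. u k \<in> V \<and>
    N (u k) \<le> C * q y * (1/2) ^ k \<and> q (y - (\<Sum>i<k. u i)) \<le> q y * (1/2) ^ k"
    using geometric_decomposition [OF V N norm_on_q q_complete] by blast
  have "norm y \<le> (\<alpha> * 2 * C) * q y" if y: "y \<in> V" for y
  proof -
    obtain u where u: "\<And>k. u k \<in> V" and Nu: "\<And>k. N (u k) \<le> C * q y * (1/2) ^ k"
      and qu: "\<And>k. q (y - (\<Sum>i<k. u i)) \<le> q y * (1/2) ^ k"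
      using dec [OF y] by metis
    have summ: "summable (\<lambda>k. C * q y * (1/2::real) ^ k)"
      by (intro summable_mult summable_geometric) simp
    obtain s where s: "s \<in> V" and weak: "\<And>f. f \<in> dual_on V N \<Longrightarrow> (\<lambda>k. f (u k)) sums f s"
      using reflexive_weak_sum [OF V N refl u Nu summ] by blast
    have "y = s"
    proof (rule eqI [OF y s])
      fix \<eta>
      assume \<eta>: "\<eta> \<in> V"
      have "(\<lambda>x. if x \<in> V then \<Theta> x \<eta> else 0) \<in> dual_on V N"
      proof (rule dual_onI [OF V])
        show "linear_functional_on V (\<lambda>x. \<Theta> x \<eta>)"
          using sesq \<eta> by (simp add: sesquilinear_on_def)
        show "cmod (\<Theta> x \<eta>) \<le> (\<beta> * N \<eta>) * N x" if "x \<in> V" for x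
          using bounded [OF that \<eta>] by (simp add: mult_ac)
      qed
      from weak [OF this] have "(\<lambda>k. \<Theta> (u k) \<eta>) sums \<Theta> s \<eta>"
        by (simp add: u s)
      then have "(\<lambda>k. \<Theta> (\<Sum>i<k. u i) \<eta>) \<longlonglongrightarrow> \<Theta> s \<eta>"
        by (simp add: sums_def sum_left [OF u \<eta>])
      moreover have "(\<lambda>k. \<Theta> (\<Sum>i<k. u i) \<eta>) \<longlonglongrightarrow> \<Theta> y \<eta>"
      proof (rule LIM_zero_cancel, rule Lim_null_comparison)
        have "cmod (\<Theta> (\<Sum>i<k. u i) \<eta> - \<Theta> y \<eta>) \<le> (q y * N \<eta>) * (1/2) ^ k" for k
        proof -
          have sV: "(\<Sum>i<k. u i) \<in> V"
            by (intro complex_vector.subspace_sum V u)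
          have "cmod (\<Theta> (\<Sum>i<k. u i) \<eta> - \<Theta> y \<eta>) = cmod (\<Theta> (y - (\<Sum>i<k. u i)) \<eta>)"
            by (simp add: diff_left y sV \<eta> norm_minus_commute)
          also have "\<dots> \<le> q (y - (\<Sum>i<k. u i)) * N \<eta>"
            by (intro q_bound complex_vector.subspace_diff V y sV \<eta>)
          also have "\<dots> \<le> (q y * (1/2) ^ k) * N \<eta>"
            using N \<eta> by (intro mult_right_mono qu) (simp add: norm_on_def)
          finally show ?thesis
            by (simp add: mult_ac)
        qed
        then show "\<forall>\<^sub>F k in sequentially.
            cmod (\<Theta> (\<Sum>i<k. u i) \<eta> - \<Theta> y \<eta>) \<le> (q y * N \<eta>) * (1/2) ^ k"
          by simp
        show "(\<lambda>k. (q y * N \<eta>) * (1/2) ^ k) \<longlonglongrightarrow> 0"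
          by (intro tendsto_mult_right_zero LIMSEQ_power_zero) simp
      qed
      ultimately show "\<Theta> y \<eta> = \<Theta> s \<eta>"
        using LIMSEQ_unique by blast
    qed
    have "(\<lambda>x. if x \<in> V then cinner x y else 0) \<in> dual_on V N"
    proof (rule dual_onI [OF V])
      show "linear_functional_on V (\<lambda>x. cinner x y)"
        by (simp add: linear_functional_on_def cinner_add_left cinner_scaleC_left)
      show "cmod (cinner x y) \<le> (\<alpha> * norm y) * N x" if "x \<in> V" for x
        using cinner_Cauchy_Schwarz [of x y] mult_right_mono [OF embed [OF that], of "norm y"]
        by (simp add: mult_ac)
    qed
    from weak [OF this] have *: "(\<lambda>k. cinner (u k) y) sums cinner y y"
      using u y \<open>y = s\<close> by simp
    have term_le: "cmod (cinner (u k) y) \<le> (\<alpha> * norm y) * (C * q y * (1/2) ^ k)" for k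
    proof -
      have "cmod (cinner (u k) y) \<le> (\<alpha> * N (u k)) * norm y"
        using cinner_Cauchy_Schwarz [of "u k" y] mult_right_mono [OF embed [OF u], of "norm y" k]
        by simp
      also have "\<dots> \<le> (\<alpha> * (C * q y * (1/2) ^ k)) * norm y"
        using \<alpha> by (intro mult_right_mono mult_left_mono Nu) auto
      finally show ?thesis
        by (simp add: mult_ac)
    qed
    have "cmod (\<Sum>k. cinner (u k) y) \<le> (\<Sum>k. (\<alpha> * norm y) * (C * q y * (1/2) ^ k))"
      by (intro norm_suminf_le term_le summable_mult summable_geometric) simp
    also have "\<dots> = (\<alpha> * norm y) * (C * q y * 2)"
      by (simp add: suminf_mult summable_geometric suminf_geometric)
    also have "(\<Sum>k. cinner (u k) y) = cinner y y"
      using sums_unique [OF *] by simp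
    finally have "(norm y)\<^sup>2 \<le> (\<alpha> * norm y) * (C * q y * 2)"
      by (simp add: cinner_self norm_power)
    then have "norm y * norm y \<le> norm y * ((\<alpha> * 2 * C) * q y)"
      by (simp add: power2_eq_square mult_ac)
    then show ?thesis
      using q_nonneg [OF y] \<alpha> C by (cases "y = 0") auto
  qed
  moreover have "\<alpha> * 2 * C \<ge> 0"
    using \<alpha> C by simp
  ultimately show ?thesis
    using that by blast
qed

text \<open>This is the adjoint equation. The functional \<open>f \<mapsto> \<langle>\<psi>, x\<rangle>\<close> on the dual, where \<open>x\<close> solves
  \<open>\<Theta> x y = cnj (f y)\<close> for all \<open>y\<close>, is linear because both conjugations cancel. It is bounded by
  \<open>norm_le_q\<close>, so by reflexivity it is the evaluation at some \<open>\<zeta>\<close>.\<close>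

theorem solve_adjoint:
  obtains \<zeta> where "\<zeta> \<in> V" and "\<And>x. x \<in> V \<Longrightarrow> \<Theta> x \<zeta> = cinner x \<psi>"
proof -
  obtain C where C: "C \<ge> 0" "\<And>y. y \<in> V \<Longrightarrow> norm y \<le> C * q y"
    using norm_le_q by blast
  have "\<exists>x\<in>V. \<forall>y\<in>V. \<Theta> x y = cnj (f y)" if "f \<in> dual_on V N" for f
  proof -
    have "conj_linear_functional_on V (\<lambda>y. cnj (f y))"
      using that by (simp add: dual_on_def linear_functional_on_def conj_linear_functional_on_def)
    moreover have "cmod (cnj (f y)) \<le> dual_norm_on V N f * N y" if "y \<in> V" for y
      using dual_on_bound [OF V N \<open>f \<in> dual_on V N\<close> that] by simp
    ultimately show ?thesis
      using solve by metis
  qed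
  then obtain X where X: "\<And>f. f \<in> dual_on V N \<Longrightarrow> X f \<in> V"
    and XX: "\<And>f y. f \<in> dual_on V N \<Longrightarrow> y \<in> V \<Longrightarrow> \<Theta> (X f) y = cnj (f y)"
    by metis
  obtain \<zeta> where \<zeta>: "\<zeta> \<in> V" and eval: "\<And>f. f \<in> dual_on V N \<Longrightarrow> cinner \<psi> (X f) = f \<zeta>"
  proof (rule reflexive_evaluation [OF refl])
    fix f g
    assume fg: "f \<in> dual_on V N" "g \<in> dual_on V N"
    have "X (f + g) = X f + X g"
      by (rule eqI)
        (simp_all add: X XX fg dual_on_add add_left complex_vector.subspace_add [OF V])
    then show "cinner \<psi> (X (f + g)) = cinner \<psi> (X f) + cinner \<psi> (X g)"
      by (simp add: cinner_add_right)
  next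
    fix c f
    assume f: "f \<in> dual_on V N"
    have "X (c *\<^sub>C f) = cnj c *\<^sub>C X f"
      by (rule eqI)
        (simp_all add: X XX f dual_on_scaleC scale_left complex_vector.subspace_scale [OF V])
    then show "cinner \<psi> (X (c *\<^sub>C f)) = c * cinner \<psi> (X f)"
      by (simp add: cinner_scaleC_right)
  next
    fix f
    assume f: "f \<in> dual_on V N"
    have "q (X f) \<le> dual_norm_on V N f"
    proof (rule q_le)
      show "0 \<le> dual_norm_on V N f"
        using f by (intro dual_norm_nonneg V N) (simp add: dual_on_def)
      show "cmod (\<Theta> (X f) y) \<le> dual_norm_on V N f * N y" if "y \<in> V" for y
        using dual_on_bound [OF V N f that] by (simp add: XX f that)
    qed
    then have "norm (X f) \<le> C * dual_norm_on V N f"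
      using C(2) [OF X [OF f]] C(1) mult_left_mono order_trans by blast
    then have "norm \<psi> * norm (X f) \<le> norm \<psi> * (C * dual_norm_on V N f)"
      by (intro mult_left_mono) auto
    with cinner_Cauchy_Schwarz [of \<psi> "X f"]
    show "cmod (cinner \<psi> (X f)) \<le> (norm \<psi> * C) * dual_norm_on V N f"
      by (simp add: mult.assoc)
  qed blast
  have "\<Theta> x \<zeta> = cinner x \<psi>" if x: "x \<in> V" for x
  proof -
    define f where "f = (\<lambda>y. if y \<in> V then cnj (\<Theta> x y) else 0)"
    have f: "f \<in> dual_on V N"
      unfolding f_def
    proof (rule dual_onI [OF V])
      show "linear_functional_on V (\<lambda>y. cnj (\<Theta> x y))"
        using conj_linear_right [OF x]
        by (simp add: linear_functional_on_def conj_linear_functional_on_def)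
      show "cmod (cnj (\<Theta> x y)) \<le> q x * N y" if "y \<in> V" for y
        using q_bound [OF x that] by simp
    qed
    have "X f = x"
      using XX [OF f] by (intro eqI X f x) (simp add: f_def)
    then have "cinner \<psi> x = cnj (\<Theta> x \<zeta>)"
      using eval [OF f] \<zeta> by (simp add: f_def)
    then show ?thesis
      by (metis cinner_commute complex_cnj_cnj)
  qed
  with \<zeta> show ?thesis
    using that by blast
qed

end

section \<open>Operators and their numerical ranges\<close>

lemma numerical_range_normalize:
  assumes T: "operator T" and \<xi>: "\<xi> \<in> dom T" "\<xi> \<noteq> 0"
  shows "cinner (T \<bullet>\<bullet> \<xi>) \<xi> / (complex_of_real (norm \<xi>))\<^sup>2 \<in> numerical_range T"
proof -
  define c where "c = complex_of_real (1 / norm \<xi>)"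
  have "c *\<^sub>C \<xi> \<in> dom T"
    using T \<xi> by (simp add: operator_def complex_vector.subspace_scale)
  moreover have "norm (c *\<^sub>C \<xi>) = 1"
    using \<xi> by (simp add: norm_scaleC c_def norm_divide)
  moreover have "T \<bullet>\<bullet> (c *\<^sub>C \<xi>) = c *\<^sub>C (T \<bullet>\<bullet> \<xi>)"
    using T \<xi> by (simp add: operator_def)
  then have "cinner (T \<bullet>\<bullet> (c *\<^sub>C \<xi>)) (c *\<^sub>C \<xi>) = cinner (T \<bullet>\<bullet> \<xi>) \<xi> / (complex_of_real (norm \<xi>))\<^sup>2"
    by (simp add: cinner_scaleC_left cinner_scaleC_right c_def power2_eq_square)
  ultimately show ?thesis
    unfolding numerical_range_def by force
qed

lemma numerical_range_distance:
  assumes T: "operator T" and \<mu>: "\<mu> \<notin> closure (numerical_range T)"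
  obtains d where "d > 0"
    and "\<And>\<xi>. \<xi> \<in> dom T \<Longrightarrow> d * (norm \<xi>)\<^sup>2 \<le> cmod (cinner (T \<bullet>\<bullet> \<xi> - \<mu> *\<^sub>C \<xi>) \<xi>)"
proof -
  obtain d where d: "d > 0" and dist: "\<And>z. z \<in> numerical_range T \<Longrightarrow> d \<le> dist z \<mu>"
    using \<mu> unfolding closure_approachable by (meson not_le)
  have "d * (norm \<xi>)\<^sup>2 \<le> cmod (cinner (T \<bullet>\<bullet> \<xi> - \<mu> *\<^sub>C \<xi>) \<xi>)" if \<xi>: "\<xi> \<in> dom T" for \<xi>
  proof (cases "\<xi> = 0")
    case False
    define r where "r = complex_of_real (norm \<xi>)"
    have "d \<le> cmod (cinner (T \<bullet>\<bullet> \<xi>) \<xi> / r\<^sup>2 - \<mu>)"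
      using dist [OF numerical_range_normalize [OF T \<xi> False]] by (simp add: dist_norm r_def)
    also have "cinner (T \<bullet>\<bullet> \<xi>) \<xi> / r\<^sup>2 - \<mu> = cinner (T \<bullet>\<bullet> \<xi> - \<mu> *\<^sub>C \<xi>) \<xi> / r\<^sup>2"
      using False by (simp add: cinner_diff_left cinner_scaleC_left cinner_self r_def field_simps)
    finally show ?thesis
      using False by (simp add: norm_divide norm_power r_def field_simps)
  qed simp
  with d show ?thesis
    using that by blast
qed

lemma bounded_below_of_distance:
  assumes "d * (norm \<xi>)\<^sup>2 \<le> cmod (cinner \<eta> \<xi>)"
  shows "d * norm \<xi> \<le> norm \<eta>"
proof (cases "\<xi> = 0")
  case False
  have "d * norm \<xi> * norm \<xi> \<le> norm \<eta> * norm \<xi>"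
    using assms cinner_Cauchy_Schwarz [of \<eta> \<xi>] by (simp add: power2_eq_square)
  then show ?thesis
    using False by simp
qed simp

lemma operator_shift:
  assumes T: "operator T" and "x \<in> dom T" "y \<in> dom T"
  shows "T \<bullet>\<bullet> (x + y) - \<mu> *\<^sub>C (x + y) = (T \<bullet>\<bullet> x - \<mu> *\<^sub>C x) + (T \<bullet>\<bullet> y - \<mu> *\<^sub>C y)"
    and "T \<bullet>\<bullet> (c *\<^sub>C x) - \<mu> *\<^sub>C c *\<^sub>C x = c *\<^sub>C (T \<bullet>\<bullet> x - \<mu> *\<^sub>C x)"
    and "T \<bullet>\<bullet> (x - y) - \<mu> *\<^sub>C (x - y) = (T \<bullet>\<bullet> x - \<mu> *\<^sub>C x) - (T \<bullet>\<bullet> y - \<mu> *\<^sub>C y)"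
proof -
  have dom: "complex_vector.subspace (dom T)"
    using T by (simp add: operator_def)
  have add: "T \<bullet>\<bullet> (u + v) = T \<bullet>\<bullet> u + T \<bullet>\<bullet> v" if "u \<in> dom T" "v \<in> dom T" for u v
    using T that by (simp add: operator_def)
  show "T \<bullet>\<bullet> (x + y) - \<mu> *\<^sub>C (x + y) = (T \<bullet>\<bullet> x - \<mu> *\<^sub>C x) + (T \<bullet>\<bullet> y - \<mu> *\<^sub>C y)"
    using assms by (simp add: add scaleC_add_right)
  have "T \<bullet>\<bullet> (c *\<^sub>C x) = c *\<^sub>C (T \<bullet>\<bullet> x)"
    using assms by (simp add: operator_def)
  then show "T \<bullet>\<bullet> (c *\<^sub>C x) - \<mu> *\<^sub>C c *\<^sub>C x = c *\<^sub>C (T \<bullet>\<bullet> x - \<mu> *\<^sub>C x)"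
    by (simp add: complex_vector.scale_right_diff_distrib scaleC_scaleC mult.commute)
  have "T \<bullet>\<bullet> (x - y) = T \<bullet>\<bullet> x - T \<bullet>\<bullet> y"
    using add [of "x - y" y] complex_vector.subspace_diff [OF dom] assms by simp
  then show "T \<bullet>\<bullet> (x - y) - \<mu> *\<^sub>C (x - y) = (T \<bullet>\<bullet> x - \<mu> *\<^sub>C x) - (T \<bullet>\<bullet> y - \<mu> *\<^sub>C y)"
    by (simp add: complex_vector.scale_right_diff_distrib)
qed

lemma resolvent_setI:
  assumes T: "operator T" and "d > 0"
    and below: "\<And>\<xi>. \<xi> \<in> dom T \<Longrightarrow> d * norm \<xi> \<le> norm (T \<bullet>\<bullet> \<xi> - \<mu> *\<^sub>C \<xi>)"
    and onto: "\<And>y. \<exists>\<xi>\<in>dom T. T \<bullet>\<bullet> \<xi> - \<mu> *\<^sub>C \<xi> = y"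
  shows "\<mu> \<in> resolvent_set T"
proof -
  define A where "A = (\<lambda>x. T \<bullet>\<bullet> x - \<mu> *\<^sub>C x)"
  define R where "R = inv_into (dom T) A"
  have dom: "complex_vector.subspace (dom T)"
    using T by (simp add: operator_def)
  have inj: "inj_on A (dom T)"
  proof (rule inj_onI)
    fix x y
    assume x: "x \<in> dom T" and y: "y \<in> dom T" and "A x = A y"
    then have "d * norm (x - y) \<le> 0"
      using below [OF complex_vector.subspace_diff [OF dom x y]] operator_shift(3) [OF T x y, of \<mu>]
      by (simp add: A_def)
    then show "x = y"
      using \<open>d > 0\<close> by (simp add: mult_le_0_iff)
  qed
  have surj: "A ` dom T = UNIV"
  proof -
    have "y \<in> A ` dom T" for y
      using onto [of y] unfolding A_def by blast
    then show ?thesis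
      by blast
  qed
  have R: "R y \<in> dom T" "A (R y) = y" for y
    unfolding R_def
    using surj inv_into_into [of y A "dom T"] f_inv_into_f [of y A "dom T"] by simp_all
  have R_eq: "R y = x" if "x \<in> dom T" "A x = y" for x y
    using inj that R by (metis inj_onD)
  have "bounded_linear R"
  proof (rule bounded_linear_intro)
    show "R (x + y) = R x + R y" for x y
      using R operator_shift(1) [OF T R(1) [of x] R(1) [of y], of \<mu>]
      by (intro R_eq complex_vector.subspace_add [OF dom]) (simp_all add: A_def)
    show "R (r *\<^sub>R x) = r *\<^sub>R R x" for r x
      unfolding scaleR_scaleC
      using R operator_shift(2) [OF T R(1) [of x] R(1) [of x], of "complex_of_real r" \<mu>]
      by (intro R_eq complex_vector.subspace_scale [OF dom]) (simp_all add: A_def)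
    show "norm (R x) \<le> norm x * (1 / d)" for x
      using below [OF R(1) [of x]] R(2) [of x] \<open>d > 0\<close> by (simp add: A_def field_simps)
  qed
  with inj surj show ?thesis
    by (simp add: resolvent_set_def bij_betw_def A_def R_def)
qed

text \<open>A vector \<open>\<eta>\<close> orthogonal to the range of \<open>T - \<mu>\<close> satisfies the premise of \<open>adjoint\<close> with
  \<open>w = cnj \<mu> *\<^sub>C \<eta>\<close>. Being thus in the domain of \<open>T\<close>, it can be paired with its own image, and the
  distance of \<open>\<mu>\<close> to the numerical range makes it vanish. Hence the range is
  dense; it is closed because \<open>T\<close> is closed and \<open>T - \<mu>\<close> is bounded below.\<close>

lemma resolvent_outside_numerical_range:
  fixes T :: "'a::complex_hilbert_space op"
  assumes T: "operator T"
    and closed: "\<And>x \<xi> v. (\<And>n::nat. x n \<in> dom T) \<Longrightarrow> x \<longlonglongrightarrow> \<xi> \<Longrightarrow>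
      (\<lambda>n. T \<bullet>\<bullet> (x n)) \<longlonglongrightarrow> v \<Longrightarrow> T \<xi> = Some v"
    and adjoint: "\<And>\<eta> w. (\<And>\<xi>. \<xi> \<in> dom T \<Longrightarrow> cinner (T \<bullet>\<bullet> \<xi>) \<eta> = cinner \<xi> w) \<Longrightarrow> \<eta> \<in> dom T"
    and \<mu>: "\<mu> \<notin> closure (numerical_range T)"
  shows "\<mu> \<in> resolvent_set T"
proof -
  have dom: "complex_vector.subspace (dom T)"
    using T by (simp add: operator_def)
  obtain d where d: "d > 0" and
    dist: "\<And>\<xi>. \<xi> \<in> dom T \<Longrightarrow> d * (norm \<xi>)\<^sup>2 \<le> cmod (cinner (T \<bullet>\<bullet> \<xi> - \<mu> *\<^sub>C \<xi>) \<xi>)"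
    using numerical_range_distance [OF T \<mu>] by blast
  have below: "d * norm \<xi> \<le> norm (T \<bullet>\<bullet> \<xi> - \<mu> *\<^sub>C \<xi>)" if "\<xi> \<in> dom T" for \<xi>
    by (rule bounded_below_of_distance [OF dist [OF that]])
  define R where "R = (\<lambda>\<xi>. T \<bullet>\<bullet> \<xi> - \<mu> *\<^sub>C \<xi>) ` dom T"
  have "complex_vector.subspace R"
  proof (rule complex_vector.subspaceI)
    have "T \<bullet>\<bullet> (0 *\<^sub>C 0) - \<mu> *\<^sub>C 0 *\<^sub>C 0 = 0 *\<^sub>C (T \<bullet>\<bullet> 0 - \<mu> *\<^sub>C 0)"
      using operator_shift(2) [OF T] complex_vector.subspace_0 [OF dom] by blast
    then show "0 \<in> R"
      unfolding R_def using complex_vector.subspace_0 [OF dom]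
      by (intro image_eqI [of _ _ 0]) (simp_all add: complex_vector.scale_zero_left)
    show "u + v \<in> R" if "u \<in> R" "v \<in> R" for u v
    proof -
      obtain x y where xy: "x \<in> dom T" "u = T \<bullet>\<bullet> x - \<mu> *\<^sub>C x" "y \<in> dom T" "v = T \<bullet>\<bullet> y - \<mu> *\<^sub>C y"
        using \<open>u \<in> R\<close> \<open>v \<in> R\<close> unfolding R_def by blast
      then have "u + v = T \<bullet>\<bullet> (x + y) - \<mu> *\<^sub>C (x + y)"
        using operator_shift(1) [OF T] by simp
      then show ?thesis
        using xy complex_vector.subspace_add [OF dom] unfolding R_def by blast
    qed
    show "c *\<^sub>C u \<in> R" if "u \<in> R" for c u
    proof -
      obtain x where x: "x \<in> dom T" "u = T \<bullet>\<bullet> x - \<mu> *\<^sub>C x"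
        using \<open>u \<in> R\<close> unfolding R_def by blast
      then have "c *\<^sub>C u = T \<bullet>\<bullet> (c *\<^sub>C x) - \<mu> *\<^sub>C c *\<^sub>C x"
        using operator_shift(2) [OF T] by simp
      then show ?thesis
        using x complex_vector.subspace_scale [OF dom] unfolding R_def by blast
    qed
  qed
  then have "closure R = UNIV"
  proof (rule dense_if_orthogonal_trivial)
    fix \<eta>
    assume orth: "\<And>x. x \<in> R \<Longrightarrow> cinner x \<eta> = 0"
    have adj: "cinner (T \<bullet>\<bullet> \<xi>) \<eta> = cinner \<xi> (cnj \<mu> *\<^sub>C \<eta>)" if "\<xi> \<in> dom T" for \<xi>
      using orth [of "T \<bullet>\<bullet> \<xi> - \<mu> *\<^sub>C \<xi>"] that
      by (simp add: R_def cinner_diff_left cinner_scaleC_left cinner_scaleC_right del: domIff)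
    then have "\<eta> \<in> dom T"
      by (rule adjoint)
    then have "d * (norm \<eta>)\<^sup>2 \<le> 0"
      using dist [of \<eta>] orth by (simp add: R_def del: domIff)
    then show "\<eta> = 0"
      using d by (simp add: mult_le_0_iff)
  qed
  have onto: "\<exists>\<xi>\<in>dom T. T \<bullet>\<bullet> \<xi> - \<mu> *\<^sub>C \<xi> = y" for y
  proof -
    obtain x where x: "\<And>n. x n \<in> dom T" and lim: "(\<lambda>n. T \<bullet>\<bullet> (x n) - \<mu> *\<^sub>C x n) \<longlonglongrightarrow> y"
    proof -
      obtain z where "\<And>n. z n \<in> R" "z \<longlonglongrightarrow> y"
        using \<open>closure R = UNIV\<close> closure_sequential [of y R] by blast
      then have "\<forall>n. \<exists>\<xi>. \<xi> \<in> dom T \<and> z n = T \<bullet>\<bullet> \<xi> - \<mu> *\<^sub>C \<xi>"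
        unfolding R_def by blast
      from choice [OF this] obtain x
        where x: "\<forall>n. x n \<in> dom T \<and> z n = T \<bullet>\<bullet> x n - \<mu> *\<^sub>C x n" ..
      then have "z = (\<lambda>n. T \<bullet>\<bullet> x n - \<mu> *\<^sub>C x n)"
        by blast
      then show ?thesis
        using that [of x] x \<open>z \<longlonglongrightarrow> y\<close> by blast
    qed
    have "Cauchy x"
    proof (rule metric_CauchyI)
      fix e :: real
      assume "e > 0"
      then have "d * e > 0"
        using d by simp
      from metric_CauchyD [OF LIMSEQ_imp_Cauchy [OF lim] this]
      obtain K where K: "\<And>m n. m \<ge> K \<Longrightarrow> n \<ge> K \<Longrightarrow>
          dist (T \<bullet>\<bullet> (x m) - \<mu> *\<^sub>C x m) (T \<bullet>\<bullet> (x n) - \<mu> *\<^sub>C x n) < d * e"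
        by meson
      have "dist (x m) (x n) < e" if "m \<ge> K" "n \<ge> K" for m n
      proof -
        have "d * dist (x m) (x n) < d * e"
          using below [OF complex_vector.subspace_diff [OF dom x x], of m n] K [OF that]
            operator_shift(3) [OF T x [of m] x [of n], of \<mu>]
          by (simp add: dist_norm)
        then show ?thesis
          using d by simp
      qed
      then show "\<exists>K. \<forall>m\<ge>K. \<forall>n\<ge>K. dist (x m) (x n) < e"
        by blast
    qed
    then obtain \<xi> where \<xi>: "x \<longlonglongrightarrow> \<xi>"
      using Cauchy_convergent_iff convergent_def by blast
    have "(\<lambda>n. \<mu> *\<^sub>C x n) \<longlonglongrightarrow> \<mu> *\<^sub>C \<xi>"
    proof (rule LIM_zero_cancel, rule Lim_null_comparison)
      show "\<forall>\<^sub>F n in sequentially. norm (\<mu> *\<^sub>C x n - \<mu> *\<^sub>C \<xi>) \<le> cmod \<mu> * norm (x n - \<xi>)"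
        by (simp add: complex_vector.scale_right_diff_distrib [symmetric] norm_scaleC)
      show "(\<lambda>n. cmod \<mu> * norm (x n - \<xi>)) \<longlonglongrightarrow> 0"
        by (intro tendsto_mult_right_zero tendsto_norm_zero LIM_zero \<xi>)
    qed
    from tendsto_add [OF lim this] have "(\<lambda>n. T \<bullet>\<bullet> (x n)) \<longlonglongrightarrow> y + \<mu> *\<^sub>C \<xi>"
      by simp
    then have "T \<xi> = Some (y + \<mu> *\<^sub>C \<xi>)"
      using closed [OF x \<xi>] by blast
    then show ?thesis
      by (intro bexI [of _ \<xi>]) auto
  qed
  show ?thesis
    by (rule resolvent_setI [OF T d below onto])
qed

text \<open>A proper convex set has a point \<open>\<mu>\<close> outside its closure. There \<open>T - \<mu>\<close> is onto, while
  \<open>T' - \<mu>\<close> is injective for every extension \<open>T'\<close> with numerical range in the set, so that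
  \<open>T'\<close> has no room to be larger.\<close>

lemma n_maximalI:
  assumes T: "operator T" and res: "- closure (numerical_range T) \<subseteq> resolvent_set T"
    and \<nn>: "\<nn> \<noteq> {}" "convex \<nn>" "\<nn> \<noteq> UNIV" and sub: "numerical_range T \<subseteq> \<nn>"
  shows "n_maximal \<nn> T"
proof -
  have "closure \<nn> \<noteq> UNIV"
    using convex_interior_closure [OF \<nn>(2)] \<nn>(3) interior_subset [of \<nn>] by auto
  then obtain \<mu> where \<mu>: "\<mu> \<notin> closure \<nn>"
    by blast
  have "\<mu> \<in> resolvent_set T"
    using res \<mu> closure_mono [OF sub] by blast
  then have onto: "\<exists>\<xi>\<in>dom T. T \<bullet>\<bullet> \<xi> - \<mu> *\<^sub>C \<xi> = y" for y
    unfolding resolvent_set_def bij_betw_def by (auto simp: set_eq_iff image_iff Bex_def) metis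
  have "T = T'" if T': "operator T'" "T \<subseteq>\<^sub>m T'" "numerical_range T' \<subseteq> \<nn>" for T'
  proof -
    have "\<mu> \<notin> closure (numerical_range T')"
      using \<mu> closure_mono [OF T'(3)] by blast
    then obtain d where d: "d > 0" and
      dist: "\<And>\<xi>. \<xi> \<in> dom T' \<Longrightarrow> d * (norm \<xi>)\<^sup>2 \<le> cmod (cinner (T' \<bullet>\<bullet> \<xi> - \<mu> *\<^sub>C \<xi>) \<xi>)"
      using numerical_range_distance [OF T'(1)] by blast
    have dom': "complex_vector.subspace (dom T')"
      using T'(1) by (simp add: operator_def)
    have sub_dom: "dom T \<subseteq> dom T'"
      using T'(2) map_le_implies_dom_le by blast
    have agree: "T \<xi> = T' \<xi>" if "\<xi> \<in> dom T" for \<xi>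
      using T'(2) that by (simp add: map_le_def)
    have "\<xi> \<in> dom T" if \<xi>: "\<xi> \<in> dom T'" for \<xi>
    proof -
      obtain \<eta> where \<eta>: "\<eta> \<in> dom T" "T \<bullet>\<bullet> \<eta> - \<mu> *\<^sub>C \<eta> = T' \<bullet>\<bullet> \<xi> - \<mu> *\<^sub>C \<xi>"
        using onto by blast
      then have \<eta>': "\<eta> \<in> dom T'"
        using sub_dom by blast
      have "T' \<bullet>\<bullet> (\<xi> - \<eta>) - \<mu> *\<^sub>C (\<xi> - \<eta>) = 0"
        using operator_shift(3) [OF T'(1) \<xi> \<eta>'] \<eta> agree by simp
      then have "d * (norm (\<xi> - \<eta>))\<^sup>2 \<le> 0"
        using dist [OF complex_vector.subspace_diff [OF dom' \<xi> \<eta>']] by simp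
      then have "\<xi> = \<eta>"
        using d by (simp add: mult_le_0_iff)
      with \<eta>(1) show ?thesis
        by simp
    qed
    then show ?thesis
      using agree sub_dom by (intro map_le_antisym T'(2)) (auto simp: map_le_def)
  qed
  with T \<nn> sub show ?thesis
    unfolding n_maximal_def by blast
qed

section \<open>The operator associated with a solvable form\<close>

lemma associated_operator_eq_Some_iff:
  assumes "closure D = UNIV"
  shows "associated_operator D \<Omega> \<xi> = Some \<zeta> \<longleftrightarrow> \<xi> \<in> D \<and> (\<forall>\<eta>\<in>D. \<Omega> \<xi> \<eta> = cinner \<zeta> \<eta>)"
proof -
  have unique: "\<zeta>' = \<zeta>" if "\<forall>\<eta>\<in>D. \<Omega> \<xi> \<eta> = cinner \<zeta> \<eta>" "\<forall>\<eta>\<in>D. \<Omega> \<xi> \<eta> = cinner \<zeta>' \<eta>" for \<zeta> \<zeta>'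
    using that by (intro cinner_eqI [OF assms]) simp
  then have the: "(THE \<zeta>. \<forall>\<eta>\<in>D. \<Omega> \<xi> \<eta> = cinner \<zeta> \<eta>) = \<zeta>" if "\<forall>\<eta>\<in>D. \<Omega> \<xi> \<eta> = cinner \<zeta> \<eta>" for \<zeta>
    using that by (intro the_equality) blast+
  show ?thesis
    unfolding associated_operator_def using the by auto
qed

lemma operator_associated_operator:
  assumes D: "complex_vector.subspace D" "closure D = UNIV" and \<Omega>: "sesquilinear_on D \<Omega>"
  shows "operator (associated_operator D \<Omega>)"
proof -
  define T where "T = associated_operator D \<Omega>"
  note iff = associated_operator_eq_Some_iff [OF D(2), of \<Omega>, folded T_def]
  have add: "\<Omega> (x + y) \<eta> = \<Omega> x \<eta> + \<Omega> y \<eta>" and scale: "\<Omega> (c *\<^sub>C x) \<eta> = c * \<Omega> x \<eta>"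
    if "x \<in> D" "y \<in> D" "\<eta> \<in> D" for x y \<eta> c
    using \<Omega> that by (simp_all add: sesquilinear_on_def linear_functional_on_def)
  have T0: "T 0 = Some 0"
    using scale [of 0 0 _ 0] by (simp add: iff complex_vector.subspace_0 [OF D(1)])
  have T_add: "T (x + y) = Some (v + w)" if "T x = Some v" "T y = Some w" for x y v w
    using that by (simp add: iff add cinner_add_left complex_vector.subspace_add [OF D(1)])
  have T_scale: "T (c *\<^sub>C x) = Some (c *\<^sub>C v)" if "T x = Some v" for c x v
    using that by (simp add: iff scale cinner_scaleC_left complex_vector.subspace_scale [OF D(1)])
  have "complex_vector.subspace (dom T)"
    by (intro complex_vector.subspaceI) (use T0 T_add T_scale in \<open>auto simp: dom_def\<close>)
  then show ?thesis
    unfolding T_def [symmetric] operator_def using T_add T_scale by auto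
qed

lemma bounded_sesquilinear_bound:
  assumes "bounded_sesquilinear \<Upsilon>"
  obtains M where "M \<ge> 0" and "\<And>\<xi> \<eta>. cmod (\<Upsilon> \<xi> \<eta>) \<le> M * norm \<xi> * norm \<eta>"
proof -
  obtain M where M: "cmod (\<Upsilon> \<xi> \<eta>) \<le> M * norm \<xi> * norm \<eta>" for \<xi> \<eta>
    using assms unfolding bounded_sesquilinear_def by blast
  have "cmod (\<Upsilon> \<xi> \<eta>) \<le> \<bar>M\<bar> * norm \<xi> * norm \<eta>" for \<xi> \<eta>
    using M [of \<xi> \<eta>] by (meson abs_ge_self mult_right_mono norm_ge_zero order_trans)
  then show ?thesis
    using that [of "\<bar>M\<bar>"] by simp
qed

locale solvable_form =
  fixes D :: "'a::complex_hilbert_space set" and \<Omega> :: "'a \<Rightarrow> 'a \<Rightarrow> complex" and N :: "'a \<Rightarrow> real"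
    and \<Upsilon> :: "'a \<Rightarrow> 'a \<Rightarrow> complex"
  assumes D: "complex_vector.subspace D" and dense: "closure D = UNIV"
    and \<Omega>: "sesquilinear_on D \<Omega>" and q_closed: "q_closed D \<Omega> N"
    and perturbation: "\<Upsilon> \<in> \<PP> D \<Omega> N"
begin

abbreviation T :: "'a op"
  where "T \<equiv> associated_operator D \<Omega>"

abbreviation \<Theta> :: "'a \<Rightarrow> 'a \<Rightarrow> complex"
  where "\<Theta> \<xi> \<eta> \<equiv> \<Omega> \<xi> \<eta> + \<Upsilon> \<xi> \<eta>"

lemmas T_iff = associated_operator_eq_Some_iff [OF dense, of \<Omega>]
lemmas operator_T = operator_associated_operator [OF D dense \<Omega>]

lemma \<Upsilon>: "bounded_sesquilinear \<Upsilon>" "sesquilinear_on UNIV \<Upsilon>"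
  using perturbation by (auto simp: perturbations_def bounded_sesquilinear_def)

lemma pairing: "\<exists>\<alpha> \<beta>. reflexive_pairing D N \<Theta> \<alpha> \<beta>"
proof -
  obtain \<alpha> \<beta> where \<alpha>: "\<alpha> > 0" "\<And>\<xi>. \<xi> \<in> D \<Longrightarrow> norm \<xi> \<le> \<alpha> * N \<xi>"
    and \<beta>: "\<And>\<xi> \<eta>. \<xi> \<in> D \<Longrightarrow> \<eta> \<in> D \<Longrightarrow> cmod (\<Omega> \<xi> \<eta>) \<le> \<beta> * N \<xi> * N \<eta>"
    and N: "norm_on D N" "reflexive_on D N"
    using q_closed unfolding q_closed_def reflexive_banach_on_def by blast
  obtain M where M: "M \<ge> 0" "\<And>\<xi> \<eta>. cmod (\<Upsilon> \<xi> \<eta>) \<le> M * norm \<xi> * norm \<eta>"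
    using bounded_sesquilinear_bound [OF \<Upsilon>(1)] by blast
  have "reflexive_pairing D N \<Theta> \<alpha> (\<beta> + M * \<alpha> * \<alpha>)"
  proof
    show "sesquilinear_on D \<Theta>"
      using \<Omega> \<Upsilon>(2)
      by (auto simp: sesquilinear_on_def linear_functional_on_def conj_linear_functional_on_def
          algebra_simps)
    show "cmod (\<Theta> \<xi> \<eta>) \<le> (\<beta> + M * \<alpha> * \<alpha>) * N \<xi> * N \<eta>" if "\<xi> \<in> D" "\<eta> \<in> D" for \<xi> \<eta>
    proof -
      have "M * norm \<xi> * norm \<eta> \<le> M * (\<alpha> * N \<xi>) * (\<alpha> * N \<eta>)"
        using \<alpha> M(1) N(1) that by (intro mult_mono mult_nonneg_nonneg) (auto simp: norm_on_def)
      then have "cmod (\<Upsilon> \<xi> \<eta>) \<le> M * \<alpha> * \<alpha> * N \<xi> * N \<eta>"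
        using M(2) [of \<xi> \<eta>] by (simp add: mult_ac)
      then show ?thesis
        using \<beta> [OF that] norm_triangle_ineq [of "\<Omega> \<xi> \<eta>" "\<Upsilon> \<xi> \<eta>"] by (simp add: distrib_right)
    qed
  qed (use D N \<alpha> perturbation in \<open>auto simp: perturbations_def\<close>)
  then show ?thesis
    by blast
qed

text \<open>Here \<open>\<eta>\<close> is in the domain of \<open>T*\<close>, with \<open>w = T* \<eta>\<close>. Let \<open>B\<close> be the bounded operator of
  \<open>\<Upsilon>\<close>. The adjoint equation has a solution \<open>\<zeta>\<close> in \<open>D\<close> with the right-hand side \<open>w + B* \<eta>\<close>, which
  means that \<open>\<langle>(T + B) \<xi>, \<zeta>\<rangle> = \<langle>(T + B) \<xi>, \<eta>\<rangle>\<close> for all \<open>\<xi>\<close> in the domain of \<open>T\<close>. As \<open>T + B\<close> is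
  onto, \<open>\<zeta> = \<eta>\<close>.\<close>

lemma adjoint_domain:
  assumes adj: "\<And>\<xi>. \<xi> \<in> dom T \<Longrightarrow> cinner (T \<bullet>\<bullet> \<xi>) \<eta> = cinner \<xi> w"
  shows "\<eta> \<in> D" and "\<And>\<xi>. \<xi> \<in> D \<Longrightarrow> \<Omega> \<xi> \<eta> = cinner \<xi> w"
proof -
  obtain \<alpha> \<beta> where "reflexive_pairing D N \<Theta> \<alpha> \<beta>"
    using pairing by blast
  then interpret reflexive_pairing D N \<Theta> \<alpha> \<beta> .
  obtain M where M: "M \<ge> 0" "\<And>\<xi> \<eta>. cmod (\<Upsilon> \<xi> \<eta>) \<le> M * norm \<xi> * norm \<eta>"
    using bounded_sesquilinear_bound [OF \<Upsilon>(1)] by blast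
  have lin: "conj_linear_functional_on UNIV (\<lambda>\<xi>. cnj (\<Upsilon> \<xi> \<eta>))"
    using \<Upsilon>(2)
    by (simp add: sesquilinear_on_def linear_functional_on_def conj_linear_functional_on_def)
  have bound: "cmod (cnj (\<Upsilon> \<xi> \<eta>)) \<le> (M * norm \<eta>) * norm \<xi>" for \<xi>
    using M(2) [of \<xi> \<eta>] by (simp add: mult_ac)
  \<comment> \<open>\<open>b'\<close> is \<open>B* \<eta>\<close>, and \<open>b\<close> below is \<open>B \<xi>\<close>\<close>
  obtain b' where "\<And>\<xi>. cnj (\<Upsilon> \<xi> \<eta>) = cinner b' \<xi>"
    by (rule Riesz_on_subspace [OF complex_vector.subspace_UNIV lin bound]) simp
  then have b': "\<Upsilon> \<xi> \<eta> = cinner \<xi> b'" for \<xi>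
    by (metis cinner_commute complex_cnj_cnj)
  obtain \<zeta> where \<zeta>: "\<zeta> \<in> D" "\<And>\<xi>. \<xi> \<in> D \<Longrightarrow> \<Theta> \<xi> \<zeta> = cinner \<xi> (w + b')"
    using solve_adjoint by blast
  have "cinner v \<zeta> = cinner v \<eta>" for v
  proof -
    have lin: "conj_linear_functional_on D (cinner v)"
      by (simp add: conj_linear_functional_on_def cinner_add_right cinner_scaleC_right)
    have bound: "cmod (cinner v y) \<le> (norm v * \<alpha>) * N y" if "y \<in> D" for y
      using cinner_Cauchy_Schwarz [of v y] mult_left_mono [OF embed [OF that], of "norm v"]
      by (simp add: mult.assoc)
    obtain \<xi> where \<xi>: "\<xi> \<in> D" "\<And>y. y \<in> D \<Longrightarrow> \<Theta> \<xi> y = cinner v y"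
      by (rule solve [OF lin bound], assumption, rule that)
    have lin_\<Upsilon>: "conj_linear_functional_on UNIV (\<Upsilon> \<xi>)"
      using \<Upsilon>(2) by (simp add: sesquilinear_on_def)
    obtain b where b: "\<And>y. \<Upsilon> \<xi> y = cinner b y"
      by (rule Riesz_on_subspace [OF complex_vector.subspace_UNIV lin_\<Upsilon> M(2)]) simp
    have "T \<xi> = Some (v - b)"
      unfolding T_iff using \<xi> b by (auto simp: cinner_diff_left algebra_simps)
    then have "cinner (v - b) \<eta> = cinner \<xi> w"
      using adj [of \<xi>] by (simp add: dom_def)
    then have "cinner v \<eta> = cinner \<xi> w + \<Upsilon> \<xi> \<eta>"
      by (simp add: cinner_diff_left b algebra_simps)
    also have "\<dots> = \<Theta> \<xi> \<zeta>"
      using \<zeta>(2) \<xi>(1) by (simp add: b' cinner_add_right)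
    also have "\<dots> = cinner v \<zeta>"
      by (rule \<xi>(2) [OF \<zeta>(1)])
    finally show ?thesis
      by simp
  qed
  then have "cinner (\<zeta> - \<eta>) (\<zeta> - \<eta>) = 0"
    by (simp add: cinner_diff_right)
  then have "\<zeta> = \<eta>"
    by (simp add: cinner_self_eq_0)
  then show "\<eta> \<in> D" and "\<And>\<xi>. \<xi> \<in> D \<Longrightarrow> \<Omega> \<xi> \<eta> = cinner \<xi> w"
    using \<zeta> b' by (auto simp: cinner_add_right)
qed

text \<open>Let \<open>y\<close> be the solution of \<open>(T + B) y = v + B \<xi>\<close>. Since \<open>(T + B) (x n)\<close> converges to
  \<open>v + B \<xi>\<close> and solutions depend continuously on the right-hand side, \<open>x n\<close> converges to \<open>y\<close>, so
  that \<open>y = \<xi>\<close>.\<close>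

lemma closed_operator:
  fixes x :: "nat \<Rightarrow> 'a"
  assumes x: "\<And>n. x n \<in> dom T" and lim: "x \<longlonglongrightarrow> \<xi>" and lim_T: "(\<lambda>n. T \<bullet>\<bullet> (x n)) \<longlonglongrightarrow> v"
  shows "T \<xi> = Some v"
proof -
  obtain \<alpha> \<beta> where "reflexive_pairing D N \<Theta> \<alpha> \<beta>"
    using pairing by blast
  then interpret reflexive_pairing D N \<Theta> \<alpha> \<beta> .
  obtain M where M: "M \<ge> 0" "\<And>\<xi> \<eta>. cmod (\<Upsilon> \<xi> \<eta>) \<le> M * norm \<xi> * norm \<eta>"
    using bounded_sesquilinear_bound [OF \<Upsilon>(1)] by blast
  have norm_le: "norm \<eta> \<le> \<alpha> * N \<eta>" if "\<eta> \<in> D" for \<eta>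
    by (rule embed [OF that])
  have "T (x n) = Some (T \<bullet>\<bullet> (x n))" for n
    using x [of n] by auto
  then have xD: "x n \<in> D" and T_x: "\<eta> \<in> D \<Longrightarrow> \<Omega> (x n) \<eta> = cinner (T \<bullet>\<bullet> (x n)) \<eta>" for n \<eta>
    unfolding T_iff by blast+
  have lin: "conj_linear_functional_on D (\<lambda>\<eta>. cinner v \<eta> + \<Upsilon> \<xi> \<eta>)"
    using \<Upsilon>(2)
    by (simp add: sesquilinear_on_def conj_linear_functional_on_def cinner_add_right
        cinner_scaleC_right algebra_simps)
  have bound: "cmod (cinner v \<eta> + \<Upsilon> \<xi> \<eta>) \<le> ((norm v + M * norm \<xi>) * \<alpha>) * N \<eta>" if "\<eta> \<in> D" for \<eta>
  proof -
    have "cmod (cinner v \<eta> + \<Upsilon> \<xi> \<eta>) \<le> (norm v + M * norm \<xi>) * norm \<eta>"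
      using cinner_Cauchy_Schwarz [of v \<eta>] M(2) [of \<xi> \<eta>] norm_triangle_ineq [of "cinner v \<eta>" "\<Upsilon> \<xi> \<eta>"]
      by (simp add: distrib_right)
    also have "\<dots> \<le> (norm v + M * norm \<xi>) * (\<alpha> * N \<eta>)"
      using M(1) by (intro mult_left_mono norm_le that) simp
    finally show ?thesis
      by (simp add: mult.assoc)
  qed
  obtain y where y: "y \<in> D" "\<And>\<eta>. \<eta> \<in> D \<Longrightarrow> \<Theta> y \<eta> = cinner v \<eta> + \<Upsilon> \<xi> \<eta>"
    by (rule solve [OF lin bound], assumption, rule that)
  obtain C where C: "C \<ge> 0" "\<And>y. y \<in> D \<Longrightarrow> norm y \<le> C * q y"
    using norm_le_q by blast
  \<comment> \<open>a bound for the distance of \<open>(T + B) (x n)\<close> to \<open>v + B \<xi>\<close>\<close>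
  define \<epsilon> where "\<epsilon> = (\<lambda>n. norm (T \<bullet>\<bullet> (x n) - v) + M * norm (x n - \<xi>))"
  have bound_y: "norm (x n - y) \<le> C * (\<epsilon> n * \<alpha>)" for n
  proof -
    have "q (x n - y) \<le> \<epsilon> n * \<alpha>"
    proof (rule q_le)
      show "0 \<le> \<epsilon> n * \<alpha>"
        using M(1) \<alpha> by (simp add: \<epsilon>_def)
      fix \<eta>
      assume \<eta>: "\<eta> \<in> D"
      have "\<Upsilon> (x n - \<xi> + \<xi>) \<eta> = \<Upsilon> (x n - \<xi>) \<eta> + \<Upsilon> \<xi> \<eta>"
        using \<Upsilon>(2) unfolding sesquilinear_on_def linear_functional_on_def by blast
      then have "\<Theta> (x n - y) \<eta> = cinner (T \<bullet>\<bullet> (x n) - v) \<eta> + \<Upsilon> (x n - \<xi>) \<eta>"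
        using diff_left [OF xD y(1) \<eta>, of n] y(2) [OF \<eta>] T_x [OF \<eta>]
        by (simp add: cinner_diff_left)
      then have "cmod (\<Theta> (x n - y) \<eta>) \<le> \<epsilon> n * norm \<eta>"
        using cinner_Cauchy_Schwarz [of "T \<bullet>\<bullet> (x n) - v" \<eta>] M(2) [of "x n - \<xi>" \<eta>]
          norm_triangle_ineq [of "cinner (T \<bullet>\<bullet> (x n) - v) \<eta>" "\<Upsilon> (x n - \<xi>) \<eta>"]
        by (simp add: \<epsilon>_def distrib_right)
      also have "\<dots> \<le> \<epsilon> n * (\<alpha> * N \<eta>)"
        using M(1) by (intro mult_left_mono norm_le \<eta>) (simp add: \<epsilon>_def)
      finally show "cmod (\<Theta> (x n - y) \<eta>) \<le> \<epsilon> n * \<alpha> * N \<eta>"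
        by (simp add: mult.assoc)
    qed
    then show ?thesis
      using C(2) [OF complex_vector.subspace_diff [OF D xD y(1)]] C(1) mult_left_mono order_trans
      by blast
  qed
  have "(\<lambda>n. C * (\<epsilon> n * \<alpha>)) \<longlonglongrightarrow> C * ((norm (v - v) + M * norm (\<xi> - \<xi>)) * \<alpha>)"
    unfolding \<epsilon>_def by (intro tendsto_intros lim lim_T)
  then have "(\<lambda>n. C * (\<epsilon> n * \<alpha>)) \<longlonglongrightarrow> 0"
    by simp
  then have "(\<lambda>n. x n - y) \<longlonglongrightarrow> 0"
    by (rule Lim_null_comparison [OF always_eventually [OF allI [OF bound_y]]])
  then have "x \<longlonglongrightarrow> y"
    by (rule LIM_zero_cancel)
  then have "y = \<xi>"
    using lim LIMSEQ_unique by blast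
  with y show ?thesis
    by (auto simp: T_iff)
qed

end

text \<open>Multiplication by \<open>c = 1 / a\<close> makes the strip horizontal, after which the imaginary part of
  the quadratic form is bounded. The shift \<open>b\<close> becomes \<open>c * b\<close>, whose imaginary part
  contributes to the bound.\<close>

lemma strip_skew_bound:
  assumes D: "complex_vector.subspace D" and \<Omega>: "sesquilinear_on D \<Omega>"
    and "strip S" and range: "form_numerical_range D \<Omega> \<subseteq> S"
  obtains c \<gamma> where "c \<noteq> 0" "\<gamma> \<ge> 0"
    "\<And>\<xi>. \<xi> \<in> D \<Longrightarrow> cmod (c * \<Omega> \<xi> \<xi> - cnj (c * \<Omega> \<xi> \<xi>)) \<le> \<gamma> * (norm \<xi>)\<^sup>2"
proof -
  obtain a and b \<delta> :: real where a: "a \<noteq> 0" and "\<delta> \<ge> 0"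
    and S: "S \<subseteq> (\<lambda>z. a * z + complex_of_real b) ` {z. \<bar>Im z\<bar> \<le> \<delta>}"
    using \<open>strip S\<close> unfolding strip_def by (metis image_mono)
  define c where "c = inverse a"
  define \<gamma> where "\<gamma> = 2 * (\<delta> + cmod (c * complex_of_real b))"
  have Im_S: "2 * \<bar>Im (c * w)\<bar> \<le> \<gamma>" if "w \<in> S" for w
  proof -
    obtain z where z: "w = a * z + complex_of_real b" "\<bar>Im z\<bar> \<le> \<delta>"
      using S \<open>w \<in> S\<close> by blast
    have "c * w = z + c * complex_of_real b"
      using a by (simp add: c_def z(1) field_simps)
    then have "\<bar>Im (c * w)\<bar> \<le> \<bar>Im z\<bar> + \<bar>Im (c * complex_of_real b)\<bar>"
      by simp
    also have "\<bar>Im (c * complex_of_real b)\<bar> \<le> cmod (c * complex_of_real b)"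
      by (rule abs_Im_le_cmod)
    finally show ?thesis
      using z(2) by (simp add: \<gamma>_def)
  qed
  have skew: "cmod (z - cnj z) = 2 * \<bar>Im z\<bar>" for z
    by (simp add: complex_diff_cnj norm_mult)
  have "cmod (c * \<Omega> \<xi> \<xi> - cnj (c * \<Omega> \<xi> \<xi>)) \<le> \<gamma> * (norm \<xi>)\<^sup>2" if \<xi>: "\<xi> \<in> D" for \<xi>
  proof (cases "\<xi> = 0")
    case True
    have "\<Omega> (0 *\<^sub>C \<xi>) \<xi> = 0 * \<Omega> \<xi> \<xi>"
      using \<Omega> \<xi> unfolding sesquilinear_on_def linear_functional_on_def by blast
    with True show ?thesis
      by (simp add: complex_vector.scale_zero_left)
  next
    case False
    define r where "r = norm \<xi>"
    have r: "r > 0"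
      using False by (simp add: r_def)
    define e where "e = complex_of_real (1 / r) *\<^sub>C \<xi>"
    have e: "e \<in> D"
      unfolding e_def by (intro complex_vector.subspace_scale D \<xi>)
    have \<xi>_eq: "\<xi> = complex_of_real r *\<^sub>C e"
      using r by (simp add: e_def scaleC_scaleC scaleC_one)
    have "\<Omega> \<xi> \<xi> = complex_of_real r * \<Omega> e \<xi>"
      using \<Omega> e \<xi> unfolding sesquilinear_on_def linear_functional_on_def by (metis \<xi>_eq)
    also have "\<Omega> e \<xi> = cnj (complex_of_real r) * \<Omega> e e"
      using \<Omega> e unfolding sesquilinear_on_def conj_linear_functional_on_def by (metis \<xi>_eq)
    finally have \<Omega>_eq: "\<Omega> \<xi> \<xi> = complex_of_real (r\<^sup>2) * \<Omega> e e"
      by (simp add: power2_eq_square)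
    have "norm e = 1"
      using r by (simp add: e_def norm_scaleC norm_divide r_def)
    then have "\<Omega> e e \<in> S"
      using range e unfolding form_numerical_range_def by blast
    have "c * \<Omega> \<xi> \<xi> = complex_of_real (r\<^sup>2) * (c * \<Omega> e e)"
      by (simp add: \<Omega>_eq)
    then have "\<bar>Im (c * \<Omega> \<xi> \<xi>)\<bar> = r\<^sup>2 * \<bar>Im (c * \<Omega> e e)\<bar>"
      by (simp only: Im_complex_of_real Re_complex_of_real times_complex.sel) (simp add: abs_mult)
    then show ?thesis
      using mult_left_mono [OF Im_S [OF \<open>\<Omega> e e \<in> S\<close>], of "r\<^sup>2"] unfolding skew r_def
      by (simp add: mult_ac)
  qed
  moreover have "c \<noteq> 0" "\<gamma> \<ge> 0"
    using a \<open>\<delta> \<ge> 0\<close> by (simp_all add: c_def \<gamma>_def)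
  ultimately show ?thesis
    using that by blast
qed

text \<open>Polarization over the fourth roots of unity bounds \<open>h x y\<close> by \<open>\<parallel>x\<parallel>\<^sup>2 + \<parallel>y\<parallel>\<^sup>2\<close>; homogeneity in \<open>y\<close> makes the bound linear.\<close>

lemma polarization_bound:
  fixes h :: "'a::complex_hilbert_space \<Rightarrow> 'a \<Rightarrow> complex"
  assumes D: "complex_vector.subspace D" and h: "sesquilinear_on D h"
    and bound: "\<And>\<xi>. \<xi> \<in> D \<Longrightarrow> cmod (h \<xi> \<xi>) \<le> \<gamma> * (norm \<xi>)\<^sup>2"
    and x: "x \<in> D" and y: "y \<in> D"
  shows "cmod (h x y) \<le> (\<gamma> * ((norm x)\<^sup>2 + 1)) * norm y"
proof -
  have left: "h (u + v) w = h u w + h v w" "h (c *\<^sub>C u) w = c * h u w"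
    if "u \<in> D" "v \<in> D" "w \<in> D" for u v w c
    using h that by (simp_all add: sesquilinear_on_def linear_functional_on_def)
  have right: "h w (u + v) = h w u + h w v" "h w (c *\<^sub>C u) = cnj c * h w u"
    if "u \<in> D" "v \<in> D" "w \<in> D" for u v w c
    using h that by (simp_all add: sesquilinear_on_def conj_linear_functional_on_def)
  note Dadd = complex_vector.subspace_add [OF D]
  note Dscale = complex_vector.subspace_scale [OF D]
  have unit: "cmod (h x e) \<le> \<gamma> * ((norm x)\<^sup>2 + (norm e)\<^sup>2)" if e: "e \<in> D" for e
  proof -
    define g where "g = (\<lambda>c. h (x + c *\<^sub>C e) (x + c *\<^sub>C e))"
    have g: "g c = h x x + cnj c * h x e + c * h e x + c * cnj c * h e e" for c
      unfolding g_def using x e by (simp add: left right Dadd Dscale algebra_simps)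
    have "4 * h x e = g 1 + \<i> * g \<i> - g (-1) - \<i> * g (-\<i>)"
      unfolding g by (simp add: algebra_simps)
    then have "cmod (4 * h x e) = cmod (g 1 + \<i> * g \<i> - g (-1) - \<i> * g (-\<i>))"
      by simp
    also have "\<dots> \<le> cmod (g 1) + cmod (g \<i>) + cmod (g (-1)) + cmod (g (-\<i>))"
      using norm_triangle_ineq4 [of "g 1 + \<i> * g \<i> - g (-1)" "\<i> * g (-\<i>)"]
        norm_triangle_ineq4 [of "g 1 + \<i> * g \<i>" "g (-1)"] norm_triangle_ineq [of "g 1" "\<i> * g \<i>"]
      by (simp add: norm_mult)
    also have "\<dots> \<le> \<gamma> * (norm (x + 1 *\<^sub>C e))\<^sup>2 + \<gamma> * (norm (x + \<i> *\<^sub>C e))\<^sup>2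
        + \<gamma> * (norm (x + (-1) *\<^sub>C e))\<^sup>2 + \<gamma> * (norm (x + (-\<i>) *\<^sub>C e))\<^sup>2"
      unfolding g_def by (intro add_mono bound Dadd Dscale x e)
    also have "\<dots> = 4 * (\<gamma> * ((norm x)\<^sup>2 + (norm e)\<^sup>2))"
      unfolding norm_add_square
      by (simp add: norm_scaleC cinner_scaleC_right cinner_minus_right algebra_simps)
    finally show ?thesis
      by (simp add: norm_mult)
  qed
  show ?thesis
  proof (cases "y = 0")
    case True
    have "h x (0 *\<^sub>C y) = cnj 0 * h x y"
      using right(2) x y by blast
    with True show ?thesis
      by (simp add: complex_vector.scale_zero_left)
  next
    case False
    define e where "e = complex_of_real (1 / norm y) *\<^sub>C y"
    have "norm e = 1"
      using False by (simp add: e_def norm_scaleC norm_divide)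
    have "e \<in> D"
      unfolding e_def by (intro Dscale y)
    have "y = complex_of_real (norm y) *\<^sub>C e"
      using False by (simp add: e_def scaleC_scaleC scaleC_one)
    then have "h x y = complex_of_real (norm y) * h x e"
      using right(2) [OF \<open>e \<in> D\<close> \<open>e \<in> D\<close> x, of "complex_of_real (norm y)"] by simp
    then show ?thesis
      using mult_right_mono [OF unit [OF \<open>e \<in> D\<close>], of "norm y"] \<open>norm e = 1\<close>
      by (simp add: norm_mult mult_ac)
  qed
qed

text \<open>The functional \<open>c * \<Omega> \<eta> \<cdot>\<close> is the conjugate of \<open>c * \<Omega> \<cdot> \<eta>\<close> up to the skew part of \<open>c * \<Omega>\<close>,
  which is bounded in the Hilbert norm.\<close>

lemma strip_continuous_swap:
  assumes D: "complex_vector.subspace D" and \<Omega>: "sesquilinear_on D \<Omega>"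
    and "strip S" and "form_numerical_range D \<Omega> \<subseteq> S"
    and \<eta>: "\<eta> \<in> D" and w: "\<And>\<xi>. \<xi> \<in> D \<Longrightarrow> \<Omega> \<xi> \<eta> = cinner \<xi> w"
  obtains \<zeta> where "\<And>\<xi>. \<xi> \<in> D \<Longrightarrow> \<Omega> \<eta> \<xi> = cinner \<zeta> \<xi>"
proof -
  obtain c \<gamma> where c: "c \<noteq> 0" and "\<gamma> \<ge> 0"
    and skew: "\<And>\<xi>. \<xi> \<in> D \<Longrightarrow> cmod (c * \<Omega> \<xi> \<xi> - cnj (c * \<Omega> \<xi> \<xi>)) \<le> \<gamma> * (norm \<xi>)\<^sup>2"
    using strip_skew_bound [OF D \<Omega> assms(3,4)] by blast
  define h where "h = (\<lambda>\<xi> \<eta>. c * \<Omega> \<xi> \<eta> - cnj (c * \<Omega> \<eta> \<xi>))"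
  have "sesquilinear_on D h"
    using \<Omega>
    by (auto simp: h_def sesquilinear_on_def linear_functional_on_def conj_linear_functional_on_def
        algebra_simps)
  then have h: "cmod (h \<eta> \<xi>) \<le> (\<gamma> * ((norm \<eta>)\<^sup>2 + 1)) * norm \<xi>" if "\<xi> \<in> D" for \<xi>
    using skew \<eta> that by (intro polarization_bound [OF D]) (simp_all add: h_def)
  define M where "M = (\<gamma> * ((norm \<eta>)\<^sup>2 + 1) + cmod c * norm w) / cmod c"
  have bound: "cmod (\<Omega> \<eta> \<xi>) \<le> M * norm \<xi>" if \<xi>: "\<xi> \<in> D" for \<xi>
  proof -
    have "c * \<Omega> \<eta> \<xi> = h \<eta> \<xi> + cnj (c * cinner \<xi> w)"
      using w [OF \<xi>] by (simp add: h_def)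
    then have "cmod c * cmod (\<Omega> \<eta> \<xi>) \<le> cmod (h \<eta> \<xi>) + cmod c * cmod (cinner \<xi> w)"
      by (metis complex_mod_cnj norm_mult norm_triangle_ineq)
    also have "\<dots> \<le> (\<gamma> * ((norm \<eta>)\<^sup>2 + 1)) * norm \<xi> + cmod c * (norm \<xi> * norm w)"
      by (intro add_mono h \<xi> mult_left_mono cinner_Cauchy_Schwarz) simp
    finally show ?thesis
      using c by (simp add: M_def field_simps)
  qed
  have lin: "conj_linear_functional_on D (\<Omega> \<eta>)"
    using \<Omega> \<eta> by (simp add: sesquilinear_on_def)
  show ?thesis
    by (rule Riesz_on_subspace [OF D lin bound], assumption, rule that)
qed

theorem theorem8p5:
  fixes D :: "'a::complex_hilbert_space set"
    and \<Omega> :: "'a \<Rightarrow> 'a \<Rightarrow> complex"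
    and N :: "'a \<Rightarrow> real"
    and S :: "complex set"
    and T :: "'a op"
  assumes "complex_vector.subspace D"
    and "closure D = UNIV"
    and "sesquilinear_on D \<Omega>"
    and "solvable D \<Omega> N"
    and "strip S"
    and "form_numerical_range D \<Omega> \<subseteq> S"
    and "T = associated_operator D \<Omega>"
  shows "- closure (numerical_range T) \<subseteq> resolvent_set T \<and>
    (\<forall>\<nn>. \<nn> \<noteq> {} \<and> convex \<nn> \<and> \<nn> \<noteq> UNIV \<and> numerical_range T \<subseteq> \<nn> \<longrightarrow> n_maximal \<nn> T)"
proof -
  obtain \<Upsilon> where "solvable_form D \<Omega> N \<Upsilon>"
    using assms(1-4) unfolding solvable_def by (auto simp: solvable_form_def)
  then interpret form: solvable_form D \<Omega> N \<Upsilon> .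
  have T: "operator T"
    using form.operator_T assms(7) by simp
  have closed: "T \<xi> = Some v"
    if "\<And>n. x n \<in> dom T" "x \<longlonglongrightarrow> \<xi>" "(\<lambda>n. T \<bullet>\<bullet> (x n)) \<longlonglongrightarrow> v" for x :: "nat \<Rightarrow> 'a" and \<xi> v
    using form.closed_operator that unfolding assms(7) by blast
  have adjoint: "\<eta> \<in> dom T"
    if adj: "\<And>\<xi>. \<xi> \<in> dom T \<Longrightarrow> cinner (T \<bullet>\<bullet> \<xi>) \<eta> = cinner \<xi> w" for \<eta> w
  proof -
    note \<eta> = form.adjoint_domain [OF adj [unfolded assms(7)]]
    obtain \<zeta> where "\<And>\<xi>. \<xi> \<in> D \<Longrightarrow> \<Omega> \<eta> \<xi> = cinner \<zeta> \<xi>"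
      using strip_continuous_swap [OF assms(1,3,5,6) \<eta>] by blast
    then show ?thesis
      using \<eta>(1) form.T_iff [of \<eta> \<zeta>] assms(7) by auto
  qed
  have "\<mu> \<in> resolvent_set T" if "\<mu> \<notin> closure (numerical_range T)" for \<mu>
    by (rule resolvent_outside_numerical_range [OF T closed adjoint that])
  then have "- closure (numerical_range T) \<subseteq> resolvent_set T"
    by blast
  with n_maximalI [OF T this] show ?thesis
    by blast
qed

end
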